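(* Let $M\in\{2,3\}$, and let $\mathbf{X}\sim N_M(\boldsymbol\mu,\Sigma)$ with $\boldsymbol\mu\in\mathbb{R}^M$ unknown and $\Sigma$ a known positive definite nondiagonal intraclass covariance matrix, with diagonal entries $1$ and off-diagonal entries $\rho$. Consider the two-sided problem $H_i:\mu_i=0$ vs. $K_i:\mu_i\ne0$, $i=1,\ldots,M$. Let $C_1>\cdots>C_M>0$ be any constants. Then the likelihood ratio step-down (LRSD) procedure with critical constants $C_1,\ldots,C_M$ is admissible; that is, for every $i\in\{1,\ldots,M\}$ the individual test of $H_i$ vs. $K_i$ induced by the LRSD procedure is admissible.
   Context: For distinct indices $j_1,\ldots,j_{m-1}$, $\mathbf{x}^{(j_1,\ldots,j_{m-1})}$ is $\mathbf{x}$ with coordinates $j_1,\ldots,j_{m-1}$ deleted, and $\Sigma_{(j_1,\ldots,j_{m-1})}$ is $\Sigma$ with those rows and columns deleted. LRSD procedure (two-sided): at stage $m=1,2,\ldots,M$, with $H_{j_1},\ldots,H_{j_{m-1}}$ already rejected, test the global hypothesis $\boldsymbol\mu^{(j_1,\ldots,j_{m-1})}=\mathbf{0}$ vs. $\boldsymbol\mu^{(j_1,\ldots,j_{m-1})}\ne\mathbf{0}$ by the likelihood ratio test, which rejects if $$\mathbf{x}^{(j_1,\ldots,j_{m-1})\prime}\,\Sigma^{-1}_{(j_1,\ldots,j_{m-1})}\,\mathbf{x}^{(j_1,\ldots,j_{m-1})}\ge C_m.$$ If the global hypothesis is not rejected, stop and accept all $H_i$ not yet rejected. If it is rejected, reject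 $H_{j_m}$, where $j_m$ maximizes $|x_j|$ over $j\in\{1,\ldots,M\}\setminus\{j_1,\ldots,j_{m-1}\}$ (ties, which have probability zero, broken by smallest index), and continue to stage $m+1$ (if $m=M$, stop). The induced individual test of $H_i$ equals $1$ at $\mathbf{x}$ if the procedure rejects $H_i$ when $\mathbf{x}$ is observed, and $0$ otherwise. Admissibility of a test $\phi$ of $H_i$ vs. $K_i$: there is no test $\phi^*:\mathbb{R}^M\to[0,1]$ such that $E_{\boldsymbol\mu}\phi^*(\mathbf{X})\le E_{\boldsymbol\mu}\phi(\mathbf{X})$ for all $\boldsymbol\mu\in\mathbb{R}^M$ with $\mu_i=0$ and $E_{\boldsymbol\mu}\phi^*(\mathbf{X})\ge E_{\boldsymbol\mu}\phi(\mathbf{X})$ for all $\boldsymbol\mu\in\mathbb{R}^M$ with $\mu_i\ne 0$, with strict inequality for at least one $\boldsymbol\mu$. *)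

theory Defs
  imports "HOL-Analysis.Analysis"
begin

definition pos_def_matrix :: "real^'n^'n \<Rightarrow> bool" where
  "pos_def_matrix A \<longleftrightarrow> transpose A = A \<and> (\<forall>x. x \<noteq> 0 \<longrightarrow> x \<bullet> (A *v x) > 0)"

text \<open>
  The law \<open>N\<^sub>M(\<mu>, \<Sigma>)\<close> with \<open>M = CARD('n)\<close>, given by its Lebesgue density.
  It is only meant for positive definite \<open>\<Sigma>\<close>.
\<close>

definition mvn_density :: "real^'n \<Rightarrow> real^'n^'n \<Rightarrow> real^'n \<Rightarrow> real" where
  "mvn_density \<mu> \<Sigma> x =
     exp (- ((x - \<mu>) \<bullet> (matrix_inv \<Sigma> *v (x - \<mu>))) / 2) / sqrt ((2 * pi) ^ CARD('n) * det \<Sigma>)"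

definition mvn :: "real^'n \<Rightarrow> real^'n^'n \<Rightarrow> (real^'n) measure" where
  "mvn \<mu> \<Sigma> = density lborel (\<lambda>x. ennreal (mvn_density \<mu> \<Sigma> x))"

definition expect_mvn :: "real^'n \<Rightarrow> real^'n^'n \<Rightarrow> (real^'n \<Rightarrow> real) \<Rightarrow> real" where
  "expect_mvn \<mu> \<Sigma> \<phi> = (\<integral>x. \<phi> x \<partial>mvn \<mu> \<Sigma>)"

text \<open>
  Deleting the coordinates in \<open>J\<close> changes the dimension, which the type \<open>real^'n\<close> cannot follow.
  Deleted entries are therefore overwritten by \<open>0\<close>: vectors and matrices indexed by \<open>-J\<close>
  correspond exactly to the vectors and matrices fixed by \<open>del_vec J\<close> and \<open>del_mat J\<close>, and this
  correspondence preserves products. The identity matrix indexed by \<open>-J\<close> is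
  \<open>del_mat J (mat 1)\<close>, so \<open>del_inv J A\<close> is the inverse of the submatrix of \<open>A\<close>
  with the rows and columns in \<open>J\<close> deleted (not a submatrix of the inverse of \<open>A\<close>).
\<close>

definition del_vec :: "'n set \<Rightarrow> real^'n \<Rightarrow> real^'n" where
  "del_vec J x = (\<chi> i. if i \<in> J then 0 else x $ i)"

definition del_mat :: "'n set \<Rightarrow> real^'n^'n \<Rightarrow> real^'n^'n" where
  "del_mat J A = (\<chi> i k. if i \<in> J \<or> k \<in> J then 0 else A $ i $ k)"

definition del_inv :: "'n set \<Rightarrow> real^'n^'n \<Rightarrow> real^'n^'n" where
  "del_inv J A = (THE B. del_mat J B = B \<and>
     del_mat J A ** B = del_mat J (mat 1) \<and> B ** del_mat J A = del_mat J (mat 1))"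

definition lr_stat :: "real^'n^'n \<Rightarrow> 'n set \<Rightarrow> real^'n \<Rightarrow> real" where
  "lr_stat \<Sigma> J x = del_vec J x \<bullet> (del_inv J \<Sigma> *v del_vec J x)"

text \<open>
  The indices \<open>1, \<dots>, M\<close> are the elements of \<open>'n\<close> in increasing order;
  the order is only used to break ties.
\<close>

definition max_abs_index :: "'n set \<Rightarrow> real^'n::{finite,linorder} \<Rightarrow> 'n" where
  "max_abs_index J x = Min {j. j \<notin> J \<and> (\<forall>k. k \<notin> J \<longrightarrow> \<bar>x $ k\<bar> \<le> \<bar>x $ j\<bar>)}"

text \<open>
  \<open>lrsd_rejects \<Sigma> C x [j\<^sub>1, \<dots>, j\<^sub>m]\<close>: the observation \<open>x\<close> makes the procedure pass the stages
  \<open>1, \<dots>, m\<close>, rejecting the hypotheses \<open>j\<^sub>1, \<dots>, j\<^sub>m\<close> in this order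
  (it may go on to reject more). Stage \<open>m + 1\<close> uses the critical constant \<open>C (m + 1)\<close>.
\<close>

inductive lrsd_rejects ::
    "real^'n::{finite,linorder}^'n::{finite,linorder} \<Rightarrow> (nat \<Rightarrow> real) \<Rightarrow>
      real^'n::{finite,linorder} \<Rightarrow> 'n list \<Rightarrow> bool"
  for \<Sigma> C x where
  start: "lrsd_rejects \<Sigma> C x []"
| stage: "lrsd_rejects \<Sigma> C x js \<Longrightarrow> length js < CARD('n) \<Longrightarrow>
    lr_stat \<Sigma> (set js) x \<ge> C (length js + 1) \<Longrightarrow>
    lrsd_rejects \<Sigma> C x (js @ [max_abs_index (set js) x])"

definition lrsd_test ::
    "real^'n::{finite,linorder}^'n::{finite,linorder} \<Rightarrow> (nat \<Rightarrow> real) \<Rightarrow> 'n \<Rightarrow>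
      real^'n::{finite,linorder} \<Rightarrow> real" where
  "lrsd_test \<Sigma> C i x = (if \<exists>js. lrsd_rejects \<Sigma> C x js \<and> i \<in> set js then 1 else 0)"

definition is_test :: "(real^'n \<Rightarrow> real) \<Rightarrow> bool" where
  "is_test \<phi> \<longleftrightarrow> \<phi> \<in> borel_measurable borel \<and> (\<forall>x. 0 \<le> \<phi> x \<and> \<phi> x \<le> 1)"

text \<open>Admissibility of \<open>\<phi>\<close> as a test of \<open>\<mu>\<^sub>i = 0\<close> vs. \<open>\<mu>\<^sub>i \<noteq> 0\<close>.\<close>

definition admissible :: "real^'n^'n \<Rightarrow> 'n \<Rightarrow> (real^'n \<Rightarrow> real) \<Rightarrow> bool" where
  "admissible \<Sigma> i \<phi> \<longleftrightarrow> \<not> (\<exists>\<phi>'. is_test \<phi>' \<and>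
     (\<forall>\<mu>. \<mu> $ i = 0 \<longrightarrow> expect_mvn \<mu> \<Sigma> \<phi>' \<le> expect_mvn \<mu> \<Sigma> \<phi>) \<and>
     (\<forall>\<mu>. \<mu> $ i \<noteq> 0 \<longrightarrow> expect_mvn \<mu> \<Sigma> \<phi>' \<ge> expect_mvn \<mu> \<Sigma> \<phi>) \<and>
     (\<exists>\<mu>. (\<mu> $ i = 0 \<and> expect_mvn \<mu> \<Sigma> \<phi>' < expect_mvn \<mu> \<Sigma> \<phi>) \<or>
          (\<mu> $ i \<noteq> 0 \<and> expect_mvn \<mu> \<Sigma> \<phi>' > expect_mvn \<mu> \<Sigma> \<phi>)))"

end

theory Submission
  imports Defs "HOL-Probability.Probability"
begin

text \<open>
  Let \<open>g\<close> be the \<open>i\<close>-th column of \<open>\<Sigma>\<close>. In the natural parameter \<open>u = \<Sigma>\<^sup>-\<^sup>1 \<mu>\<close> the hypothesis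
  \<open>\<mu>\<^sub>i = 0\<close> reads \<open>u \<bullet> g = 0\<close>. If a test is at least as good as \<open>\<phi>\<close>, the difference \<open>D\<close> of the two
  has power function \<open>0\<close> on the hyperplane \<open>u \<bullet> g = 0\<close>, with vanishing normal derivative and
  nonnegative second normal derivative. By completeness of the exponential family, the zeroth and
  first moments of \<open>D\<close> times the density vanish on almost every line in direction \<open>g\<close>. If the
  acceptance region of \<open>\<phi>\<close> meets every such line in an interval, \<open>D\<close> is nonnegative on the interval and
  nonpositive off it, so the second moment is nonpositive, and it vanishes only for \<open>D = 0\<close>.

  For the step-down procedure, each statistic that still involves \<open>x\<^sub>i\<close> is \<open>x\<^sub>i\<^sup>2\<close> plus a
  constant on such a line, and \<open>H\<^sub>i\<close> is accepted iff for some set \<open>J\<close> of largest coordinates, \<open>i \<notin> J\<close>,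
  the statistic is below its critical constant. For \<open>M \<le> 3\<close> this set is star-shaped about the point
  of the line with \<open>x\<^sub>i = 0\<close>, hence an interval.
\<close>

section \<open>Functions integrable against all exponentials\<close>

text \<open>The weights \<open>exp (s * norm x)\<close>, taken for all s, dominate polynomials and
  linear exponentials, so tilting by \<open>exp (x \<bullet> u)\<close> and taking moments never
  leaves the class.\<close>

definition exp_integrable :: "('a::euclidean_space \<Rightarrow> real) \<Rightarrow> bool" where
  "exp_integrable f \<longleftrightarrow> f \<in> borel_measurable borel \<and>
     (\<forall>s. integrable lborel (\<lambda>x. exp (s * norm x) * f x))"

lemma exp_integrable_measurable [measurable_dest]:
  "exp_integrable f \<Longrightarrow> f \<in> borel_measurable borel"
  by (simp add: exp_integrable_def)

lemma exp_integrable_mult: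
  assumes f: "exp_integrable f"
    and [measurable]: "h \<in> borel_measurable borel"
    and h: "\<And>x. \<bar>h x\<bar> \<le> K * exp (s * norm x)"
  shows "exp_integrable (\<lambda>x. h x * f x)"
  unfolding exp_integrable_def
proof (intro conjI allI)
  note [measurable] = exp_integrable_measurable[OF f]
  show "(\<lambda>x. h x * f x) \<in> borel_measurable borel" by measurable
  fix t
  have i: "integrable lborel (\<lambda>x. K * (exp ((s + t) * norm x) * f x))"
    using f unfolding exp_integrable_def by (intro integrable_mult_right) blast
  show "integrable lborel (\<lambda>x. exp (t * norm x) * (h x * f x))"
  proof (rule Bochner_Integration.integrable_bound[OF i])
    show "AE x in lborel. norm (exp (t * norm x) * (h x * f x)) \<le> norm (K * (exp ((s + t) * norm x) * f x))"
    proof (rule AE_I2)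
      fix x
      have "norm (exp (t * norm x) * (h x * f x)) = \<bar>h x\<bar> * (exp (t * norm x) * \<bar>f x\<bar>)"
        by (simp add: abs_mult)
      also have "\<dots> \<le> (K * exp (s * norm x)) * (exp (t * norm x) * \<bar>f x\<bar>)"
        by (intro mult_right_mono h) auto
      also have "\<dots> = K * (exp ((s + t) * norm x) * \<bar>f x\<bar>)"
        by (simp add: algebra_simps exp_add)
      also have "\<dots> \<le> norm (K * (exp ((s + t) * norm x) * f x))"
        by (simp add: abs_mult mult_right_mono)
      finally show "norm (exp (t * norm x) * (h x * f x)) \<le> norm (K * (exp ((s + t) * norm x) * f x))" .
    qed
  qed measurable
qed

lemma exp_integrable_integrable: "exp_integrable f \<Longrightarrow> integrable lborel f"
  using exp_integrable_def[of f] by (auto dest: spec[of _ 0])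

lemma exp_integrable_exp:
  assumes "exp_integrable f"
  shows "exp_integrable (\<lambda>x. exp (x \<bullet> v) * f x)"
  by (rule exp_integrable_mult[OF assms, where K=1 and s="norm v"])
    (auto intro: order_trans[OF norm_cauchy_schwarz] simp: mult.commute)

lemma exp_integrable_inner:
  assumes "exp_integrable f"
  shows "exp_integrable (\<lambda>x. (x \<bullet> v) * f x)"
proof (rule exp_integrable_mult[OF assms, where K="norm v" and s=1])
  fix x
  have "\<bar>x \<bullet> v\<bar> \<le> norm x * norm v" by (rule Cauchy_Schwarz_ineq2)
  also have "\<dots> \<le> exp (norm x) * norm v"
    by (intro mult_right_mono order_trans[OF _ exp_ge_add_one_self]) auto
  finally show "\<bar>x \<bullet> v\<bar> \<le> norm v * exp (1 * norm x)" by (simp add: mult.commute)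
qed auto

lemma exp_integrable_bounded:
  assumes "exp_integrable f" "h \<in> borel_measurable borel" "\<And>x. \<bar>h x\<bar> \<le> 1"
  shows "exp_integrable (\<lambda>x. h x * f x)"
  by (rule exp_integrable_mult[OF assms(1,2), where K=1 and s=0]) (use assms(3) in auto)

text \<open>The exponential series is integrated term by term by dominated convergence. The scalar
  type is left general so that one expansion serves real z (Laplace transform) and complex z
  (characteristic function).\<close>

lemma exp_integral_sums:
  fixes z :: "'b::{real_normed_field, banach, second_countable_topology}"
  assumes f: "exp_integrable f"
  shows "(\<lambda>n. of_real ((\<integral>x. f x * (x \<bullet> v) ^ n \<partial>lborel) / fact n) * z ^ n) sums
    (\<integral>x. of_real (f x) * exp (z * of_real (x \<bullet> v)) \<partial>lborel)"
proof -
  note [measurable] = exp_integrable_measurable[OF f]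
  let ?L = "\<lambda>x. x \<bullet> v"
  have pow: "exp_integrable (\<lambda>x. ?L x ^ n * f x)" for n
    by (induction n) (use f in \<open>auto simp: mult.assoc intro: exp_integrable_inner\<close>)
  have part: "(\<Sum>k<n. of_real ((\<integral>x. f x * ?L x ^ k \<partial>lborel) / fact k) * z ^ k) =
    (\<integral>x. of_real (f x) * (\<Sum>k<n. (z * of_real (?L x)) ^ k /\<^sub>R fact k) \<partial>lborel)" for n
  proof -
    have i: "integrable lborel (\<lambda>x. of_real (?L x ^ k * f x) * (z ^ k / of_real (fact k)))" for k
      by (intro integrable_mult_left integrable_of_real exp_integrable_integrable pow)
    have "(\<integral>x. of_real (f x) * (\<Sum>k<n. (z * of_real (?L x)) ^ k /\<^sub>R fact k) \<partial>lborel) =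
      (\<integral>x. (\<Sum>k<n. of_real (?L x ^ k * f x) * (z ^ k / of_real (fact k))) \<partial>lborel)"
      by (intro Bochner_Integration.integral_cong refl)
        (simp add: sum_distrib_left power_mult_distrib scaleR_conv_of_real field_simps)
    also have "\<dots> = (\<Sum>k<n. of_real (\<integral>x. ?L x ^ k * f x \<partial>lborel) * (z ^ k / of_real (fact k)))"
      by (subst Bochner_Integration.integral_sum[OF i])
        (simp add: exp_integrable_integrable pow del: of_real_mult of_real_power)
    finally show ?thesis by (simp add: mult.commute)
  qed
  have "(\<lambda>n. \<integral>x. of_real (f x) * (\<Sum>k<n. (z * of_real (?L x)) ^ k /\<^sub>R fact k) \<partial>lborel) \<longlonglongrightarrow>
    (\<integral>x. of_real (f x) * exp (z * of_real (?L x)) \<partial>lborel)"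
  proof (rule integral_dominated_convergence[where w="\<lambda>x. exp (norm z * norm v * norm x) * \<bar>f x\<bar>"])
    show "integrable lborel (\<lambda>x. exp (norm z * norm v * norm x) * \<bar>f x\<bar>)"
      using f integrable_abs[of lborel "\<lambda>x. exp (norm z * norm v * norm x) * f x"]
      unfolding exp_integrable_def by (simp add: abs_mult)
    show "AE x in lborel. (\<lambda>n. of_real (f x) * (\<Sum>k<n. (z * of_real (?L x)) ^ k /\<^sub>R fact k)) \<longlonglongrightarrow>
        of_real (f x) * exp (z * of_real (?L x))"
      by (intro AE_I2 tendsto_mult tendsto_const) (use exp_converges in \<open>auto simp: sums_def\<close>)
    show "AE x in lborel. norm (of_real (f x) * (\<Sum>k<n. (z * of_real (?L x)) ^ k /\<^sub>R fact k)) \<le>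
        exp (norm z * norm v * norm x) * \<bar>f x\<bar>" for n
    proof (rule AE_I2)
      fix x
      let ?y = "z * of_real (?L x) :: 'b"
      have ny: "norm ?y \<le> norm z * norm v * norm x"
        using Cauchy_Schwarz_ineq2[of x v] by (simp add: norm_mult mult.assoc mult_left_mono mult.commute[of "norm v"])
      have "norm (\<Sum>k<n. ?y ^ k /\<^sub>R fact k) \<le> (\<Sum>k<n. norm ?y ^ k /\<^sub>R fact k)"
        by (rule order_trans[OF norm_sum]) (simp add: norm_power)
      also have "\<dots> \<le> exp (norm ?y)"
        unfolding exp_def by (intro sum_le_suminf summable_exp_generic) auto
      also have "\<dots> \<le> exp (norm z * norm v * norm x)" using ny by simp
      finally show "norm (of_real (f x) * (\<Sum>k<n. ?y ^ k /\<^sub>R fact k)) \<le> exp (norm z * norm v * norm x) * \<bar>f x\<bar>"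
        by (simp add: norm_mult mult.commute mult_left_mono)
    qed
  qed measurable
  then show ?thesis unfolding sums_def part .
qed

section \<open>Everywhere convergent power series near zero\<close>

text \<open>Once the first m coefficients vanish, \<open>h s / s ^ m\<close> is again a power
  series, with constant term \<open>a m\<close>.\<close>

lemma powser_quotient_limit:
  fixes a :: "nat \<Rightarrow> real"
  assumes h: "\<And>s. (\<lambda>n. a n * s ^ n) sums h s"
    and a: "\<And>k. k < m \<Longrightarrow> a k = 0"
  shows "((\<lambda>s. h s / s ^ m) \<longlongrightarrow> a m) (at 0)"
proof -
  have "((\<lambda>s. h s / s ^ m) \<longlongrightarrow> a (0 + m)) (at 0)"
  proof (rule powser_limit_0_strong[where s=1 and a="\<lambda>n. a (n + m)"])
    fix s :: real assume "s \<noteq> 0"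
    have "(\<lambda>n. a (n + m) * s ^ (n + m)) sums h s"
      using sums_iff_shift[of "\<lambda>n. a n * s ^ n" m "h s"] h[of s] a by simp
    from sums_divide[OF this, of "s ^ m"] show "(\<lambda>n. a (n + m) * s ^ n) sums (h s / s ^ m)"
      using \<open>s \<noteq> 0\<close> by (simp add: power_add)
  qed simp
  then show ?thesis by simp
qed

lemma powser_eq_0_imp_coeff_0:
  fixes a :: "nat \<Rightarrow> real"
  assumes "\<And>s. (\<lambda>n. a n * s ^ n) sums 0"
  shows "a n = 0"
proof (induction n rule: less_induct)
  case (less n)
  from powser_quotient_limit[of a "\<lambda>_. 0", OF assms less] show ?case
    using LIM_unique[of "\<lambda>_. 0" 0 0 "a n"] by (simp add: tendsto_const_iff)
qed

text \<open>The first and second order conditions at a minimum, read off the coefficients. The limit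
  of \<open>h s\<close> makes \<open>a 0\<close> nonnegative, the one-sided limits of
  \<open>h s / s\<close> have opposite signs, and then \<open>h s / s ^ 2\<close> gives the sign of
  \<open>a 2\<close>. Below, h is the difference of powers along a line crossing the null hyperplane
  at s = 0.\<close>

lemma powser_local_min:
  fixes a :: "nat \<Rightarrow> real"
  assumes h: "\<And>s. (\<lambda>n. a n * s ^ n) sums h s"
    and pos: "\<And>s. s \<noteq> 0 \<Longrightarrow> h s \<ge> 0" and h0: "h 0 \<le> 0"
  shows "a 0 = 0" "a 1 = 0" "a 2 \<ge> 0"
proof -
  have "h 0 = a 0"
    using sums_unique2[OF h[of 0] powser_sums_zero[of a]] .
  moreover have "0 \<le> a 0"
    using powser_quotient_limit[OF h, of 0]
    by (rule tendsto_lowerbound) (auto simp: eventually_at_filter pos)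
  ultimately show a0: "a 0 = 0" using h0 by simp
  have l1: "((\<lambda>s. h s / s) \<longlongrightarrow> a 1) (at 0)"
    using powser_quotient_limit[OF h, of 1] a0 by simp
  have "0 \<le> a 1"
    using filterlim_mono[OF l1 order_refl at_le[of "{0<..}" UNIV 0]]
    by (rule tendsto_lowerbound) (auto simp: eventually_at_filter pos)
  moreover have "a 1 \<le> 0"
    using filterlim_mono[OF l1 order_refl at_le[of "{..<0}" UNIV 0]]
    by (rule tendsto_upperbound) (auto simp: eventually_at_filter pos divide_nonneg_neg)
  ultimately show a1: "a 1 = 0" by simp
  have "((\<lambda>s. h s / s ^ 2) \<longlongrightarrow> a 2) (at 0)"
    by (rule powser_quotient_limit[OF h]) (use a0 a1 in \<open>auto simp: less_2_cases_iff\<close>)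
  then show "0 \<le> a 2"
    by (rule tendsto_lowerbound) (auto simp: eventually_at_filter pos)
qed

section \<open>Completeness of the exponential family\<close>

lemma density_inner_distribution:
  fixes f :: "'a::euclidean_space \<Rightarrow> real"
  assumes [measurable]: "integrable lborel f" and f: "\<And>x. 0 \<le> f x" "(\<integral>x. f x \<partial>lborel) = 1"
  shows "real_distribution (distr (density lborel f) borel (\<lambda>x. x \<bullet> v))" (is "real_distribution ?M")
    and "\<And>h :: real \<Rightarrow> 'b::{banach, second_countable_topology}. h \<in> borel_measurable borel \<Longrightarrow>
      (\<integral>y. h y \<partial>distr (density lborel f) borel (\<lambda>x. x \<bullet> v)) = (\<integral>x. f x *\<^sub>R h (x \<bullet> v) \<partial>lborel)"
proof -
  have "emeasure (density lborel f) (space (density lborel f)) = 1"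
    using f by (simp add: emeasure_density nn_integral_eq_integral assms(1))
  then interpret prob_space "density lborel f" by (rule prob_spaceI)
  show "real_distribution ?M"
    by (intro real_distribution.intro prob_space_distr real_distribution_axioms.intro) auto
  show "(\<integral>y. h y \<partial>?M) = (\<integral>x. f x *\<^sub>R h (x \<bullet> v) \<partial>lborel)"
    if [measurable]: "h \<in> borel_measurable borel" for h :: "real \<Rightarrow> 'b"
    by (subst integral_distr) (auto simp: integral_density f)
qed

text \<open>A vanishing Laplace transform makes all moments of \<open>x \<bullet> v\<close> vanish, hence also the
  characteristic function, to which Levy's theorem applies.\<close>

lemma exp_integral_eq_0_imp:
  assumes f: "exp_integrable f"
    and 0: "\<And>s. (\<integral>x. f x * exp (s * (x \<bullet> v)) \<partial>lborel) = 0"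
    and [measurable]: "B \<in> sets borel"
  shows "(\<integral>x. f x * indicator B (x \<bullet> v) \<partial>lborel) = 0"
proof -
  note [measurable] = exp_integrable_measurable[OF f]
  note fi = exp_integrable_integrable[OF f]
  define a where "a n = (\<integral>x. f x * (x \<bullet> v) ^ n \<partial>lborel) / fact n" for n
  have a0: "a n = 0" for n
    by (rule powser_eq_0_imp_coeff_0)
      (use exp_integral_sums[OF f, where v=v and 'b=real] 0 in \<open>simp add: a_def\<close>)
  have char0: "(\<integral>x. of_real (f x) * exp (z * of_real (x \<bullet> v)) \<partial>lborel) = 0" for z :: complex
    using exp_integral_sums[OF f, of v z] a0 unfolding a_def
    by (simp add: sums_iff)
  \<comment> \<open>Positive and negative part have the same mass c, because the transform vanishes
    at s = 0. If c = 0 then f is null; otherwise division by c turns both into probability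
    densities, as Levy's uniqueness theorem requires.\<close>
  let ?p = "\<lambda>x. max 0 (f x)" and ?n = "\<lambda>x. max 0 (- f x)"
  have pn: "f x = ?p x - ?n x" for x by auto
  have ip: "integrable lborel ?p" and "in": "integrable lborel ?n"
    using fi by auto
  define c where "c = integral\<^sup>L lborel ?p"
  have "integral\<^sup>L lborel f = integral\<^sup>L lborel ?p - integral\<^sup>L lborel ?n"
    using ip "in" by (subst Bochner_Integration.integral_diff[symmetric]) (auto simp flip: pn)
  then have cn: "integral\<^sup>L lborel ?n = c" using 0[of 0] by (simp add: c_def)
  show ?thesis
  proof (cases "c = 0")
    case True
    have "AE x in lborel. ?p x = 0" "AE x in lborel. ?n x = 0"
      using True cn integral_nonneg_eq_0_iff_AE[OF ip] integral_nonneg_eq_0_iff_AE[OF "in"]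
      by (auto simp: c_def)
    then have "AE x in lborel. f x * indicator B (x \<bullet> v) = 0"
      by eventually_elim (subst pn, simp)
    then show ?thesis by (rule integral_eq_zero_AE)
  next
    case False
    moreover have "0 \<le> c" unfolding c_def by (rule Bochner_Integration.integral_nonneg) simp
    ultimately have c: "c > 0" by simp
    let ?p' = "\<lambda>x. ?p x / c" and ?n' = "\<lambda>x. ?n x / c"
    let ?P = "distr (density lborel ?p') borel (\<lambda>x. x \<bullet> v)"
    let ?N = "distr (density lborel ?n') borel (\<lambda>x. x \<bullet> v)"
    have p': "integrable lborel ?p'" "\<And>x. 0 \<le> ?p' x" "(\<integral>x. ?p' x \<partial>lborel) = 1"
      using ip c by (auto simp: c_def)
    have n': "integrable lborel ?n'" "\<And>x. 0 \<le> ?n' x" "(\<integral>x. ?n' x \<partial>lborel) = 1"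
      using "in" c cn by auto
    have "char ?P = char ?N"
    proof
      fix t
      have b: "integrable lborel (\<lambda>x. h x *\<^sub>R iexp (t * (x \<bullet> v)))" if "integrable lborel h" for h
        by (rule Bochner_Integration.integrable_bound[OF that]) (use that in auto)
      have "char ?P t - char ?N t = (\<integral>x. ?p' x *\<^sub>R iexp (t * (x \<bullet> v)) - ?n' x *\<^sub>R iexp (t * (x \<bullet> v)) \<partial>lborel)"
        unfolding char_def
        by (subst density_inner_distribution(2)[OF p'], simp, subst density_inner_distribution(2)[OF n'], simp,
          rule Bochner_Integration.integral_diff[symmetric]) (intro b p' n')+
      also have "\<dots> = (\<integral>x. of_real (f x) * exp (\<i> * t * of_real (x \<bullet> v)) / c \<partial>lborel)"
        by (intro Bochner_Integration.integral_cong refl)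
          (auto simp: scaleR_conv_of_real field_simps max_def)
      also have "\<dots> = 0" using char0[of "\<i> * t"] by simp
      finally show "char ?P t = char ?N t" by simp
    qed
    then have "?P = ?N"
      by (intro Levy_uniqueness density_inner_distribution(1) p' n')
    then have "(\<integral>y. indicator B y \<partial>?P) = (\<integral>y. indicator B y \<partial>?N :: real)" by simp
    then have "(\<integral>x. ?p' x *\<^sub>R indicator B (x \<bullet> v) \<partial>lborel) = (\<integral>x. ?n' x *\<^sub>R indicator B (x \<bullet> v) \<partial>lborel :: real)"
      by (subst (asm) density_inner_distribution(2)[OF p'], simp, subst (asm) density_inner_distribution(2)[OF n']) simp_all
    then have e: "(\<integral>x. ?p x * indicator B (x \<bullet> v) \<partial>lborel) = (\<integral>x. ?n x * indicator B (x \<bullet> v) \<partial>lborel)"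
      using c by simp
    have "(\<integral>x. f x * indicator B (x \<bullet> v) \<partial>lborel) =
      (\<integral>x. ?p x * indicator B (x \<bullet> v) - ?n x * indicator B (x \<bullet> v) \<partial>lborel)"
      by (intro Bochner_Integration.integral_cong refl) (auto simp: indicator_def max_def)
    also have "\<dots> = 0"
      by (subst Bochner_Integration.integral_diff)
        (use e in \<open>auto intro!: integrable_real_mult_indicator simp: measurable_sets_borel 
           intro: Bochner_Integration.integrable_bound[OF ip] Bochner_Integration.integrable_bound[OF "in"] split: split_indicator\<close>)
    finally show ?thesis .
  qed
qed

text \<open>Induction that adds one indicator at a time by the one-dimensional result. The factor
  \<open>exp (x \<bullet> u)\<close> is carried along because the step for \<open>v c\<close> needs
  the hypothesis at \<open>u + s *\<^sub>R v c\<close> for every s, and V contains these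
  points.\<close>

lemma exp_integral_eq_0_imp_prod:
  assumes f: "exp_integrable f" and V: "subspace V"
    and 0: "\<And>u. u \<in> V \<Longrightarrow> (\<integral>x. f x * exp (x \<bullet> u) \<partial>lborel) = 0"
    and I: "finite I" "\<And>b. b \<in> I \<Longrightarrow> v b \<in> V" "\<And>b. b \<in> I \<Longrightarrow> B b \<in> sets borel"
    and u: "u \<in> V"
  shows "(\<integral>x. f x * (\<Prod>b\<in>I. indicator (B b) (x \<bullet> v b)) * exp (x \<bullet> u) \<partial>lborel) = 0"
  using I u
proof (induction I arbitrary: u rule: finite_induct)
  case empty
  then show ?case using 0 by simp
next
  case (insert c I)
  have [measurable]: "B b \<in> sets borel" if "b \<in> insert c I" for b using insert.prems that by simp
  define f' where "f' = (\<lambda>x. (\<Prod>b\<in>I. indicator (B b) (x \<bullet> v b)) * f x)"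
  have "exp_integrable f'"
    unfolding f'_def
  proof (rule exp_integrable_bounded[OF f])
    show "(\<lambda>x. \<Prod>b\<in>I. indicator (B b) (x \<bullet> v b) :: real) \<in> borel_measurable borel"
      by (rule borel_measurable_prod) measurable
    show "\<bar>\<Prod>b\<in>I. indicator (B b) (x \<bullet> v b) :: real\<bar> \<le> 1" for x
      unfolding abs_prod by (intro prod_le_1) (auto simp: indicator_def)
  qed
  then have g: "exp_integrable (\<lambda>x. exp (x \<bullet> u) * f' x)" by (rule exp_integrable_exp)
  have "(\<integral>x. exp (x \<bullet> u) * f' x * indicator (B c) (x \<bullet> v c) \<partial>lborel) = 0"
  proof (rule exp_integral_eq_0_imp[OF g])
    fix s
    have "(\<integral>x. f x * (\<Prod>b\<in>I. indicator (B b) (x \<bullet> v b)) * exp (x \<bullet> (u + s *\<^sub>R v c)) \<partial>lborel) = 0"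
      using insert.prems V by (intro insert.IH) (auto simp: subspace_def)
    then show "(\<integral>x. exp (x \<bullet> u) * f' x * exp (s * (x \<bullet> v c)) \<partial>lborel) = 0"
      by (simp add: f'_def inner_add_right exp_add mult_ac)
  qed simp
  then show ?case using insert.hyps by (simp add: f'_def mult_ac)
qed

lemma indicator_box_eq_prod:
  "indicator (box a b) y = (\<Prod>i\<in>Basis. indicator {a \<bullet> i<..<b \<bullet> i} (y \<bullet> i) :: real)"
proof (cases "y \<in> box a b")
  case True
  then show ?thesis by (auto simp: mem_box intro!: prod.neutral[symmetric])
next
  case False
  then obtain i where i: "i \<in> Basis" "y \<bullet> i \<notin> {a \<bullet> i<..<b \<bullet> i}" by (auto simp: mem_box)
  then have "(\<Prod>i\<in>Basis. indicator {a \<bullet> i<..<b \<bullet> i} (y \<bullet> i) :: real) = 0"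
    by (intro prod_zero bexI[of _ i]) simp_all
  then show ?thesis using False by simp
qed

text \<open>The map \<open>x \<mapsto> x - (x \<bullet> w) g\<close> is the projection along \<open>g\<close> onto the orthogonal
  complement of \<open>w\<close>, so these indicators are the functions invariant under translation by \<open>g\<close>.
  They generalise from boxes, whose indicators factor over the coordinates.\<close>

lemma exp_integral_eq_0_imp_invariant:
  fixes g w :: "'a::euclidean_space"
  assumes f: "exp_integrable f" and wg: "w \<bullet> g = 1"
    and 0: "\<And>u. u \<bullet> g = 0 \<Longrightarrow> (\<integral>x. f x * exp (x \<bullet> u) \<partial>lborel) = 0"
    and A: "A \<in> sets borel"
  shows "(\<integral>x. f x * indicator A (x - (x \<bullet> w) *\<^sub>R g) \<partial>lborel) = 0"
proof -
  note [measurable] = exp_integrable_measurable[OF f]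
  note fi = exp_integrable_integrable[OF f]
  let ?Q = "\<lambda>x. x - (x \<bullet> w) *\<^sub>R g"
  have box: "(\<integral>x. f x * indicator (box a b) (?Q x) \<partial>lborel) = 0" for a b
  proof -
    \<comment> \<open>\<open>v i\<close> is the adjoint of the projection applied to the basis
      vector i; since \<open>w \<bullet> g = 1\<close> it is orthogonal to g.\<close>
    define v where "v i = i - (g \<bullet> i) *\<^sub>R w" for i
    have v: "?Q x \<bullet> i = x \<bullet> v i" for x i by (simp add: v_def algebra_simps)
    have "(\<integral>x. f x * (\<Prod>i\<in>Basis. indicator {a \<bullet> i<..<b \<bullet> i} (x \<bullet> v i)) * exp (x \<bullet> 0) \<partial>lborel) = 0"
      by (rule exp_integral_eq_0_imp_prod[OF f subspace_hyperplane2[of g] 0])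
        (use wg in \<open>auto simp: v_def inner_diff_right inner_commute\<close>)
    then show ?thesis by (simp add: indicator_box_eq_prod v)
  qed
  let ?p = "\<lambda>x. max 0 (f x)" and ?n = "\<lambda>x. max 0 (- f x)"
  have ip: "integrable lborel ?p" and "in": "integrable lborel ?n"
    using fi by auto
  \<comment> \<open>The image under the projection of the measure with density h. For the positive
    and the negative part of f these images are finite on boxes and agree there; boxes are stable
    under intersection and generate the Borel sets.\<close>
  define N where "N h = distr (density lborel (\<lambda>x. ennreal (h x))) borel ?Q" for h :: "'a \<Rightarrow> real"
  have i: "integrable lborel (\<lambda>x. h x * indicator X (?Q x))"
    if "integrable lborel h" "X \<in> sets borel" for h :: "'a \<Rightarrow> real" and X
    by (rule Bochner_Integration.integrable_bound[OF that(1)])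
      (use that in \<open>auto simp: indicator_def\<close>)
  have N: "emeasure (N h) X = ennreal (\<integral>x. h x * indicator X (?Q x) \<partial>lborel)"
    if h: "integrable lborel h" "\<And>x. 0 \<le> h x" and X[measurable]: "X \<in> sets borel" for h X
  proof -
    have [measurable]: "h \<in> borel_measurable borel" using h(1) by auto
    have [measurable]: "?Q -` X \<in> sets borel" using measurable_sets[of ?Q borel borel X] by simp
    have "emeasure (N h) X = (\<integral>\<^sup>+x. ennreal (h x) * indicator (?Q -` X) x \<partial>lborel)"
      by (simp add: N_def emeasure_distr emeasure_density)
    also have "\<dots> = (\<integral>\<^sup>+x. ennreal (h x * indicator X (?Q x)) \<partial>lborel)"
      by (intro nn_integral_cong) (auto simp: indicator_def)
    also have "\<dots> = ennreal (\<integral>x. h x * indicator X (?Q x) \<partial>lborel)"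
      by (intro nn_integral_eq_integral i h X) (use h in auto)
    finally show ?thesis .
  qed
  have diff: "(\<integral>x. f x * indicator X (?Q x) \<partial>lborel) =
    (\<integral>x. ?p x * indicator X (?Q x) \<partial>lborel) - (\<integral>x. ?n x * indicator X (?Q x) \<partial>lborel)"
    if "X \<in> sets borel" for X
  proof -
    have "(\<integral>x. f x * indicator X (?Q x) \<partial>lborel) =
      (\<integral>x. ?p x * indicator X (?Q x) - ?n x * indicator X (?Q x) \<partial>lborel)"
      by (intro Bochner_Integration.integral_cong refl) (auto simp: indicator_def max_def)
    then show ?thesis
      using Bochner_Integration.integral_diff[OF i[OF ip that] i[OF "in" that]] by simp
  qed
  have "N ?p = N ?n"
  proof (rule measure_eqI_generator_eq)
    let ?E = "range (\<lambda>(a, b). box a b::'a set)"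
    show "Int_stable ?E"
      by (auto simp: Int_stable_def box_Int_box)
    show "?E \<subseteq> Pow UNIV" "sets (N ?p) = sigma_sets UNIV ?E" "sets (N ?n) = sigma_sets UNIV ?E"
      by (simp_all add: borel_eq_box N_def)
    let ?A = "\<lambda>n::nat. box (- (real n *\<^sub>R One)) (real n *\<^sub>R One) :: 'a set"
    show "range ?A \<subseteq> ?E" "(\<Union>i. ?A i) = UNIV"
      unfolding UN_box_eq_UNIV by auto
    show "emeasure (N ?p) (?A i) \<noteq> \<infinity>" for i by (simp add: N ip)
    show "emeasure (N ?p) X = emeasure (N ?n) X" if E: "X \<in> ?E" for X
    proof -
      obtain a b where X: "X = box a b" using E by auto
      show ?thesis using diff[of X] box[of a b] by (simp add: N ip "in" X)
    qed
  qed
  then have "ennreal (\<integral>x. ?p x * indicator A (?Q x) \<partial>lborel) = ennreal (\<integral>x. ?n x * indicator A (?Q x) \<partial>lborel)"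
    using N[OF ip _ A] N[OF "in" _ A] by simp
  then have "(\<integral>x. ?p x * indicator A (?Q x) \<partial>lborel) = (\<integral>x. ?n x * indicator A (?Q x) \<partial>lborel)"
    by (subst (asm) ennreal_inj) (auto intro!: integral_nonneg_AE)
  then show ?thesis using diff[OF A] by simp
qed

section \<open>Integrals along parallel lines\<close>

text \<open>For fixed r the shear only translates x, so the inner integral over x is unchanged when
  r is integrated last.\<close>

lemma lborel_shear_distr:
  fixes g :: "'a::euclidean_space"
  shows "distr (lborel \<Otimes>\<^sub>M lborel) (borel \<Otimes>\<^sub>M borel) (\<lambda>(x, r::real). (x + r *\<^sub>R g, r)) = lborel \<Otimes>\<^sub>M lborel"
    (is "distr ?P ?B ?T = ?P")
proof (rule measure_eqI)
  have [measurable]: "?T \<in> ?P \<rightarrow>\<^sub>M ?B" by measurable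
  show "sets (distr ?P ?B ?T) = sets ?P"
    by (simp cong: sets_pair_measure_cong)
  fix X assume "X \<in> sets (distr ?P ?B ?T)"
  then have X[measurable]: "X \<in> sets (borel \<Otimes>\<^sub>M borel)" by simp
  then have X'[measurable]: "X \<in> sets ?P" by (simp cong: sets_pair_measure_cong)
  have "emeasure (distr ?P ?B ?T) X = (\<integral>\<^sup>+z. indicator X (?T z) \<partial>?P)"
    by (subst nn_integral_indicator[symmetric], simp, subst nn_integral_distr) simp_all
  also have "\<dots> = (\<integral>\<^sup>+r. \<integral>\<^sup>+x. indicator X (x + r *\<^sub>R g, r) \<partial>lborel \<partial>lborel)"
    by (subst lborel_pair.nn_integral_snd[symmetric]) auto
  also have "\<dots> = (\<integral>\<^sup>+r. \<integral>\<^sup>+x. indicator X (x, r) \<partial>lborel \<partial>lborel)"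
  proof (rule nn_integral_cong)
    fix r :: real
    have "(\<integral>\<^sup>+x. indicator X (x, r) \<partial>lborel) = (\<integral>\<^sup>+x. indicator X (x, r) \<partial>distr lborel borel ((+) (r *\<^sub>R g)))"
      by (simp add: lborel_distr_plus)
    also have "\<dots> = (\<integral>\<^sup>+x. indicator X (x + r *\<^sub>R g, r) \<partial>lborel)"
      by (subst nn_integral_distr) (auto simp: add.commute)
    finally show "(\<integral>\<^sup>+x. indicator X (x + r *\<^sub>R g, r) \<partial>lborel) = (\<integral>\<^sup>+x. indicator X (x, r) \<partial>lborel)" by simp
  qed
  also have "\<dots> = (\<integral>\<^sup>+z. indicator X z \<partial>?P)"
    by (subst lborel_pair.nn_integral_snd[symmetric]) auto
  finally show "emeasure (distr ?P ?B ?T) X = emeasure ?P X" by simp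
qed

text \<open>Integration over the lines in direction \<open>g\<close> without choosing coordinates: the Gaussian
  weight in \<open>x \<bullet> w\<close> has total mass \<open>1\<close> on each line.\<close>

lemma
  fixes f :: "'a::euclidean_space \<Rightarrow> real"
  assumes f: "integrable lborel f" and wg: "w \<bullet> g = 1"
  shows AE_integrable_line: "AE x in lborel. integrable lborel (\<lambda>r. f (x + r *\<^sub>R g))"
    and integrable_line_integral:
      "integrable lborel (\<lambda>x. std_normal_density (x \<bullet> w) * (\<integral>r. f (x + r *\<^sub>R g) \<partial>lborel))"
    and integral_line_integral:
      "(\<integral>x. std_normal_density (x \<bullet> w) * (\<integral>r. f (x + r *\<^sub>R g) \<partial>lborel) \<partial>lborel) = (\<integral>x. f x \<partial>lborel)"
proof -
  have [measurable]: "f \<in> borel_measurable borel" using f by auto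
  let ?k = std_normal_density
  let ?T = "\<lambda>(x, r::real). (x + r *\<^sub>R g, r)"
  \<comment> \<open>Integrating out r gives back f, since the weight has mass 1. Composed with the
    shear, the argument of the weight becomes
    \<open>(x + r *\<^sub>R g) \<bullet> w - r = x \<bullet> w\<close>, which is free of r and can
    leave the line integral.\<close>
  define G where "G = (\<lambda>(x, r). f x * ?k (x \<bullet> w - r))"
  have [measurable]: "G \<in> borel_measurable (borel \<Otimes>\<^sub>M borel)" unfolding G_def by measurable
  have [measurable]: "?T \<in> lborel \<Otimes>\<^sub>M lborel \<rightarrow>\<^sub>M borel \<Otimes>\<^sub>M borel" by measurable
  have ki: "integrable lborel (\<lambda>r. ?k (c - r))" and k1: "(\<integral>r. ?k (c - r) \<partial>lborel) = 1" for c
    using lborel_integrable_real_affine_iff[of "-1" ?k c] lborel_integral_real_affine[of "-1" ?k c]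
    by (simp_all add: integrable_normal_moment)
  have G: "integrable (lborel \<Otimes>\<^sub>M lborel) G"
  proof (rule lborel_pair.Fubini_integrable)
    have "(\<integral>r. norm (G (x, r)) \<partial>lborel) = norm (f x)" for x
      by (simp add: G_def abs_mult k1)
    then show "integrable lborel (\<lambda>x. \<integral>r. norm (G (x, r)) \<partial>lborel)" using f by simp
    show "AE x in lborel. integrable lborel (\<lambda>r. G (x, r))"
      by (simp add: G_def ki)
  qed simp
  define F where "F = (\<lambda>(x, r). ?k (x \<bullet> w) * f (x + r *\<^sub>R g))"
  have F: "F z = G (?T z)" for z
    using wg by (cases z) (simp add: F_def G_def inner_commute inner_add_right inner_add_left)
  have iF: "integrable (lborel \<Otimes>\<^sub>M lborel) F"
    unfolding F[abs_def] by (rule integrable_distr[where M'="borel \<Otimes>\<^sub>M borel"])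
      (simp_all add: lborel_shear_distr G)
  have "AE x in lborel. integrable lborel (\<lambda>r. F (x, r))"
    using iF by (rule lborel_pair.AE_integrable_fst')
  then show "AE x in lborel. integrable lborel (\<lambda>r. f (x + r *\<^sub>R g))"
  proof eventually_elim
    case (elim x)
    have "?k (x \<bullet> w) > 0" by (simp add: normal_density_pos)
    with elim show ?case by (simp add: F_def)
  qed
  show "integrable lborel (\<lambda>x. ?k (x \<bullet> w) * (\<integral>r. f (x + r *\<^sub>R g) \<partial>lborel))"
    using lborel_pair.integrable_fst'[OF iF] by (simp add: F_def)
  have "(\<integral>x. ?k (x \<bullet> w) * (\<integral>r. f (x + r *\<^sub>R g) \<partial>lborel) \<partial>lborel) = (\<integral>x. (\<integral>r. F (x, r) \<partial>lborel) \<partial>lborel)"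
    by (simp add: F_def)
  also have "\<dots> = (\<integral>z. F z \<partial>(lborel \<Otimes>\<^sub>M lborel))"
    by (rule lborel_pair.integral_fst'[OF iF])
  also have "\<dots> = (\<integral>z. G z \<partial>distr (lborel \<Otimes>\<^sub>M lborel) (borel \<Otimes>\<^sub>M borel) ?T)"
    unfolding F by (subst integral_distr) auto
  also have "\<dots> = (\<integral>z. G z \<partial>(lborel \<Otimes>\<^sub>M lborel))"
    by (simp add: lborel_shear_distr)
  also have "\<dots> = (\<integral>x. (\<integral>r. G (x, r) \<partial>lborel) \<partial>lborel)"
    by (rule lborel_pair.integral_fst'[OF G, symmetric])
  also have "\<dots> = (\<integral>x. f x \<partial>lborel)"
    by (simp add: G_def k1)
  finally show "(\<integral>x. ?k (x \<bullet> w) * (\<integral>r. f (x + r *\<^sub>R g) \<partial>lborel) \<partial>lborel) = (\<integral>x. f x \<partial>lborel)" .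
qed

text \<open>The line integral S is itself invariant under translation by g, so the indicator of S >
  0 is an admissible invariant factor. With it the weighted integral of \<open>max 0 (S x)\<close>
  is 0, hence S is nonpositive almost everywhere; the same applied to -f gives the other
  sign.\<close>

lemma AE_line_integral_eq_0:
  fixes f :: "'a::euclidean_space \<Rightarrow> real"
  assumes f: "exp_integrable f" and wg: "w \<bullet> g = 1"
    and 0: "\<And>u. u \<bullet> g = 0 \<Longrightarrow> (\<integral>x. f x * exp (x \<bullet> u) \<partial>lborel) = 0"
  shows "AE x in lborel. (\<integral>r. f (x + r *\<^sub>R g) \<partial>lborel) = 0"
proof -
  let ?k = std_normal_density
  have nonpos: "AE x in lborel. (\<integral>r. h (x + r *\<^sub>R g) \<partial>lborel) \<le> 0"
    if h: "exp_integrable h"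
      and h0: "\<And>u. u \<bullet> g = 0 \<Longrightarrow> (\<integral>x. h x * exp (x \<bullet> u) \<partial>lborel) = 0" for h
  proof -
    note [measurable] = exp_integrable_measurable[OF h]
    define S where "S x = (\<integral>r. h (x + r *\<^sub>R g) \<partial>lborel)" for x
    have [measurable]: "S \<in> borel_measurable borel"
      unfolding S_def by measurable
    define A where "A = {x. S x > 0}"
    have A[measurable]: "A \<in> sets borel" unfolding A_def by measurable
    define h' where "h' x = h x * indicator A (x - (x \<bullet> w) *\<^sub>R g)" for x
    have "integral\<^sup>L lborel h' = 0"
      unfolding h'_def by (rule exp_integral_eq_0_imp_invariant[OF h wg h0 A])
    have ih': "integrable lborel h'"
      unfolding h'_def
      by (rule Bochner_Integration.integrable_bound[OF exp_integrable_integrable[OF h]])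
        (auto simp: indicator_def)
    have inv: "S (x + s *\<^sub>R g) = S x" for x s
      unfolding S_def
      by (subst lborel_integral_real_affine[of 1 "\<lambda>r. h (x + r *\<^sub>R g)" s])
        (simp_all add: algebra_simps)
    have line: "(\<integral>r. h' (x + r *\<^sub>R g) \<partial>lborel) = max 0 (S x)" for x
    proof -
      have "(x + r *\<^sub>R g) - ((x + r *\<^sub>R g) \<bullet> w) *\<^sub>R g = x + (- (x \<bullet> w)) *\<^sub>R g" for r
        using wg by (simp add: inner_commute inner_add_right algebra_simps)
      then have "h' (x + r *\<^sub>R g) = h (x + r *\<^sub>R g) * indicator A x" for r
        unfolding h'_def by (simp only: A_def mem_Collect_eq indicator_def inv)
      then show ?thesis by (simp add: S_def A_def indicator_def)
    qed
    have "(\<integral>x. ?k (x \<bullet> w) * max 0 (S x) \<partial>lborel) = 0"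
      using integral_line_integral[OF ih' wg] \<open>integral\<^sup>L lborel h' = 0\<close> by (simp add: line)
    then have "AE x in lborel. ?k (x \<bullet> w) * max 0 (S x) = 0"
      using integrable_line_integral[OF ih' wg]
      by (subst (asm) integral_nonneg_eq_0_iff_AE) (auto simp: line)
    then show ?thesis
    proof eventually_elim
      case (elim x)
      have "?k (x \<bullet> w) > 0" by (simp add: normal_density_pos)
      with elim show ?case by (simp add: S_def)
    qed
  qed
  have "exp_integrable (\<lambda>x. - f x)"
    using exp_integrable_bounded[OF f, of "\<lambda>_. -1"] by simp
  from nonpos[OF this] 0 have "AE x in lborel. (\<integral>r. - f (x + r *\<^sub>R g) \<partial>lborel) \<le> 0" by simp
  moreover have "AE x in lborel. (\<integral>r. f (x + r *\<^sub>R g) \<partial>lborel) \<le> 0"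
    by (rule nonpos[OF f 0])
  ultimately show ?thesis
    by eventually_elim simp
qed

section \<open>Tests with interval sections\<close>

text \<open>The sign changes of \<open>q\<close> are matched by the polynomial \<open>a + b r + c r\<^sup>2\<close> with \<open>c \<ge> 0\<close>;
  integrating against it leaves only the second moment.\<close>

lemma sign_polynomial_second_moment:
  fixes q :: "real \<Rightarrow> real"
  assumes i: "integrable lborel q" "integrable lborel (\<lambda>r. r * q r)" "integrable lborel (\<lambda>r. r\<^sup>2 * q r)"
    and m: "(\<integral>r. q r \<partial>lborel) = 0" "(\<integral>r. r * q r \<partial>lborel) = 0"
    and c: "c \<ge> 0" and sgn: "\<forall>r. q r * (a + b * r + c * r\<^sup>2) \<le> 0"
    and nz: "finite {r. a + b * r + c * r\<^sup>2 = 0}"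
  shows "(\<integral>r. r\<^sup>2 * q r \<partial>lborel) \<le> 0"
    and "(\<integral>r. r\<^sup>2 * q r \<partial>lborel) = 0 \<Longrightarrow> AE r in lborel. q r = 0"
proof -
  let ?s = "\<lambda>r. - (a * q r + b * (r * q r) + c * (r\<^sup>2 * q r))"
  have s: "?s r = - (q r * (a + b * r + c * r\<^sup>2))" for r by (simp add: algebra_simps)
  have int: "(\<integral>r. ?s r \<partial>lborel) = - c * (\<integral>r. r\<^sup>2 * q r \<partial>lborel)"
    using i m by simp
  have nonneg: "0 \<le> ?s r" for r using sgn unfolding s by simp
  have zero: "AE r in lborel. q r = 0" if "(\<integral>r. ?s r \<partial>lborel) = 0"
  proof -
    have "AE r in lborel. ?s r = 0"
      using that i nonneg by (subst (asm) integral_nonneg_eq_0_iff_AE) auto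
    moreover have "AE r in lborel. r \<notin> {r. a + b * r + c * r\<^sup>2 = 0}"
      by (intro AE_not_in finite_imp_null_set_lborel nz)
    ultimately show ?thesis
      unfolding s by eventually_elim simp
  qed
  show "AE r in lborel. q r = 0" if "(\<integral>r. r\<^sup>2 * q r \<partial>lborel) = 0"
    using zero that int by simp
  show "(\<integral>r. r\<^sup>2 * q r \<partial>lborel) \<le> 0"
  proof (cases "c = 0")
    \<comment> \<open>Without a quadratic term, the two vanishing moments alone already force q = 0
      almost everywhere.\<close>
    case True
    then have "AE r in lborel. q r = 0" using zero int by simp
    then have "(\<integral>r. r\<^sup>2 * q r \<partial>lborel) = 0"
      by (intro integral_eq_zero_AE) auto
    then show ?thesis by simp
  next
    case False
    have "0 \<le> - c * (\<integral>r. r\<^sup>2 * q r \<partial>lborel)"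
      unfolding int[symmetric] by (rule Bochner_Integration.integral_nonneg) (rule nonneg)
    then show ?thesis using False c by (simp add: mult_le_0_iff)
  qed
qed

text \<open>The roots are placed at the finite endpoints of I: a quadratic for two of them, an
  affine function for one, a constant for none. At an endpoint the product is 0, so open and closed
  ends are treated alike.\<close>

lemma interval_sign_polynomial:
  fixes I :: "real set" and q :: "real \<Rightarrow> real"
  assumes I: "is_interval I" and pos: "\<And>r. r \<in> I \<Longrightarrow> 0 \<le> q r" and neg: "\<And>r. r \<notin> I \<Longrightarrow> q r \<le> 0"
  obtains a b c where "c \<ge> 0" "\<forall>r. q r * (a + b * r + c * r\<^sup>2) \<le> 0" "finite {r. a + b * r + c * r\<^sup>2 = 0}"
proof -
  have mem: "r \<in> I" if "\<exists>x\<in>I. x < r" "\<exists>y\<in>I. r < y" for r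
    using I that unfolding is_interval_1 by (meson less_imp_le)
  have below: "\<exists>x\<in>I. x < r" if "bdd_below I" "I \<noteq> {}" "Inf I < r" for r
    using that by (simp add: cInf_less_iff)
  have above: "\<exists>x\<in>I. r < x" if "bdd_above I" "I \<noteq> {}" "r < Sup I" for r
    using that by (simp add: less_cSup_iff)
  have nbelow: "\<exists>x\<in>I. x < r" if "\<not> bdd_below I" for r
    using that by (meson bdd_below.I2 linorder_not_less bdd_belowI)
  have nabove: "\<exists>x\<in>I. r < x" if "\<not> bdd_above I" for r
    using that by (meson linorder_not_less bdd_aboveI)
  consider "I = {}" | "I \<noteq> {}" "bdd_below I" "bdd_above I" | "I \<noteq> {}" "bdd_below I" "\<not> bdd_above I"
    | "I \<noteq> {}" "\<not> bdd_below I" "bdd_above I" | "I \<noteq> {}" "\<not> bdd_below I" "\<not> bdd_above I"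
    by argo
  then show ?thesis
  proof cases
    case 1
    then have "q r \<le> 0" for r by (intro neg) simp
    then show ?thesis by (intro that[of 0 1 0]) simp_all
  next
    case 2
    define l where "l = Inf I" define u where "u = Sup I"
    have e: "l * u + (- (l + u)) * r + 1 * r\<^sup>2 = (r - l) * (r - u)" for r
      by (simp add: algebra_simps power2_eq_square)
    have lu: "l \<le> u" using 2 unfolding l_def u_def by (intro cInf_le_cSup)
    have "q r * ((r - l) * (r - u)) \<le> 0" for r
    proof -
      consider "r < l" | "u < r" | "r = l" | "r = u" | "l < r" "r < u" by linarith
      then show ?thesis
      proof cases
        case 1
        then have "r \<notin> I" using 2 cInf_lower[of r I] by (auto simp: l_def)
        then have "q r \<le> 0" by (rule neg)
        moreover have "0 \<le> (r - l) * (r - u)" using 1 lu by (intro mult_nonpos_nonpos) auto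
        ultimately show ?thesis by (rule mult_nonpos_nonneg)
      next
        assume 3: "u < r"
        then have "r \<notin> I" using 2 cSup_upper[of r I] by (auto simp: u_def)
        then have "q r \<le> 0" by (rule neg)
        moreover have "0 \<le> (r - l) * (r - u)" using 3 lu by (intro mult_nonneg_nonneg) auto
        ultimately show ?thesis by (rule mult_nonpos_nonneg)
      next
        assume 3: "l < r" "r < u"
        then have "r \<in> I" using below[of r] above[of r] 2 by (intro mem) (simp_all add: l_def u_def)
        then have "0 \<le> q r" by (rule pos)
        moreover have "(r - l) * (r - u) \<le> 0" using 3 by (intro mult_nonneg_nonpos) auto
        ultimately show ?thesis by (rule mult_nonneg_nonpos)
      qed auto
    qed
    moreover have "finite {r. (r - l) * (r - u) = 0}"
      by (rule finite_subset[of _ "{l, u}"]) auto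
    ultimately show ?thesis by (intro that[of 1 "l * u" "- (l + u)"]) (simp_all only: e, simp)
  next
    case 3
    define l where "l = Inf I"
    have "q r * (l - r) \<le> 0" for r
    proof (cases r l rule: linorder_cases)
      case less
      then have "r \<notin> I" using 3 cInf_lower[of r I] by (auto simp: l_def)
      then show ?thesis using less neg by (simp add: mult_nonpos_nonneg)
    next
      case greater
      then have "r \<in> I" using below[of r] nabove[of r] 3 by (intro mem) (simp_all add: l_def)
      then show ?thesis using greater pos by (simp add: mult_nonneg_nonpos)
    qed simp
    then show ?thesis by (intro that[of 0 l "-1"]) auto
  next
    case 4
    define u where "u = Sup I"
    have "q r * (- u + r) \<le> 0" for r
    proof (cases r u rule: linorder_cases)
      case greater
      then have "r \<notin> I" using 4 cSup_upper[of r I] by (auto simp: u_def)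
      then show ?thesis using greater neg by (simp add: mult_nonpos_nonneg)
    next
      case less
      then have "r \<in> I" using above[of r] nbelow[of r] 4 by (intro mem) (simp_all add: u_def)
      then show ?thesis using less pos by (simp add: mult_nonneg_nonpos)
    qed simp
    moreover have "{r. - u + r = 0} = {u}" by auto
    ultimately show ?thesis by (intro that[of 0 "- u" 1]) auto
  next
    case 5
    then have "r \<in> I" for r using nabove[of r] nbelow[of r] by (intro mem) simp_all
    then show ?thesis using pos by (intro that[of 0 "-1" 0]) auto
  qed
qed

text \<open>The sufficiency half of a theorem of Matthes and Truax. Since the power is not larger on the
  null hypothesis and not smaller off it, on almost every line in direction \<open>g\<close> the integrals of
  \<open>D p\<close> and of \<open>(x \<bullet> w) D p\<close> vanish, while the total second moment is nonnegative;
  the sign pattern of \<open>D\<close> then forces \<open>D = 0\<close>.\<close>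

lemma interval_sections_unbeatable:
  fixes D p :: "'a::euclidean_space \<Rightarrow> real"
  assumes p: "exp_integrable p" and p_pos: "\<And>x. p x > 0"
    and D: "D \<in> borel_measurable borel" "\<And>x. \<bar>D x\<bar> \<le> 1"
    and g: "g \<noteq> 0"
    and null: "\<And>u. u \<bullet> g = 0 \<Longrightarrow> (\<integral>x. D x * p x * exp (x \<bullet> u) \<partial>lborel) \<le> 0"
    and alt: "\<And>u. u \<bullet> g \<noteq> 0 \<Longrightarrow> (\<integral>x. D x * p x * exp (x \<bullet> u) \<partial>lborel) \<ge> 0"
    and I: "\<And>x. is_interval {r. x + r *\<^sub>R g \<in> A}"
    and pos: "\<And>x. x \<in> A \<Longrightarrow> 0 \<le> D x" and neg: "\<And>x. x \<notin> A \<Longrightarrow> D x \<le> 0"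
  shows "AE x in lborel. D x = 0"
proof -
  \<comment> \<open>With this scaling \<open>x \<bullet> w\<close> serves as the parameter on each
    line in direction g.\<close>
  define w where "w = (1 / (g \<bullet> g)) *\<^sub>R g"
  have wg: "w \<bullet> g = 1" using g by (simp add: w_def)
  define f where "f = (\<lambda>x. D x * p x)"
  have f: "exp_integrable f" unfolding f_def by (rule exp_integrable_bounded[OF p D])
  have f1: "exp_integrable (\<lambda>x. (x \<bullet> w) * f x)" by (rule exp_integrable_inner[OF f])
  have f2: "exp_integrable (\<lambda>x. (x \<bullet> w)\<^sup>2 * f x)"
    using exp_integrable_inner[OF f1, of w] by (simp add: power2_eq_square mult.assoc)
  have moments: "(\<integral>x. f x * exp (x \<bullet> u) \<partial>lborel) = 0"
    "(\<integral>x. (x \<bullet> w) * f x * exp (x \<bullet> u) \<partial>lborel) = 0"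
    "(\<integral>x. (x \<bullet> w)\<^sup>2 * f x * exp (x \<bullet> u) \<partial>lborel) \<ge> 0" if u: "u \<bullet> g = 0" for u
  proof -
    define h where "h = (\<lambda>x. exp (x \<bullet> u) * f x)"
    have h: "exp_integrable h" unfolding h_def by (rule exp_integrable_exp[OF f])
    have e: "(\<integral>x. h x * exp (s * (x \<bullet> w)) \<partial>lborel) = (\<integral>x. D x * p x * exp (x \<bullet> (u + s *\<^sub>R w)) \<partial>lborel)" for s
      by (simp add: h_def f_def inner_add_right exp_add mult_ac)
    have ug: "(u + s *\<^sub>R w) \<bullet> g = s" for s using u wg by (simp add: inner_add_left)
    let ?a = "\<lambda>n. (\<integral>x. h x * (x \<bullet> w) ^ n \<partial>lborel) / fact n"
    \<comment> \<open>By \<open>ug\<close> the path \<open>u + s *\<^sub>R w\<close> meets the null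
      hyperplane only at s = 0, so H satisfies the hypotheses of \<open>powser_local_min\<close>;
      its coefficients are the moments of \<open>x \<bullet> w\<close> divided by
      factorials.\<close>
    define H where "H s = (\<integral>x. h x * exp (s * (x \<bullet> w)) \<partial>lborel)" for s
    have sums: "(\<lambda>n. ?a n * s ^ n) sums H s" for s
      using exp_integral_sums[OF h, of w s] by (simp add: H_def)
    have H: "s \<noteq> 0 \<Longrightarrow> 0 \<le> H s" "H 0 \<le> 0" for s
      using alt[of "u + s *\<^sub>R w"] null[of "u + 0 *\<^sub>R w"] unfolding ug H_def e by simp_all
    have "?a 0 = 0" "?a 1 = 0" "?a 2 \<ge> 0"
      using powser_local_min[of ?a H, OF sums H] by blast+
    then show "(\<integral>x. f x * exp (x \<bullet> u) \<partial>lborel) = 0"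
      "(\<integral>x. (x \<bullet> w) * f x * exp (x \<bullet> u) \<partial>lborel) = 0"
      "(\<integral>x. (x \<bullet> w)\<^sup>2 * f x * exp (x \<bullet> u) \<partial>lborel) \<ge> 0"
      by (simp_all add: h_def mult_ac zero_le_divide_iff)
  qed
  define S where "S x = (\<integral>r. ((x + r *\<^sub>R g) \<bullet> w)\<^sup>2 * f (x + r *\<^sub>R g) \<partial>lborel)" for x
  have zero: "AE x in lborel. (\<integral>r. f (x + r *\<^sub>R g) \<partial>lborel) = 0"
    "AE x in lborel. (\<integral>r. (x + r *\<^sub>R g) \<bullet> w * f (x + r *\<^sub>R g) \<partial>lborel) = 0"
    by (rule AE_line_integral_eq_0[OF f wg moments(1)], assumption)
      (rule AE_line_integral_eq_0[OF f1 wg moments(2)], assumption)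
  have line: "AE x in lborel. S x \<le> 0 \<and> (S x = 0 \<longrightarrow> (AE r in lborel. f (x + r *\<^sub>R g) = 0))"
    using AE_integrable_line[OF exp_integrable_integrable[OF f] wg]
      AE_integrable_line[OF exp_integrable_integrable[OF f1] wg]
      AE_integrable_line[OF exp_integrable_integrable[OF f2] wg]
      zero
  proof eventually_elim
    case (elim x)
    txt \<open>The origin of the line is moved so that its parameter becomes \<open>x \<bullet> w\<close>.\<close>
    define q where "q r = f (x - (x \<bullet> w) *\<^sub>R g + r *\<^sub>R g)" for r
    have q: "f (x + r *\<^sub>R g) = q (x \<bullet> w + r)" for r
      by (simp add: q_def algebra_simps)
    have w: "(x + r *\<^sub>R g) \<bullet> w = x \<bullet> w + r" for r
      using wg by (simp add: inner_add_left inner_commute[of g])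
    have aff: "integrable lborel (\<lambda>r. k (x \<bullet> w + r)) \<longleftrightarrow> integrable lborel k"
      "(\<integral>r. k (x \<bullet> w + r) \<partial>lborel) = integral\<^sup>L lborel k" for k :: "real \<Rightarrow> real"
      using lborel_integrable_real_affine_iff[of 1 k "x \<bullet> w"] lborel_integral_real_affine[of 1 k "x \<bullet> w"]
      by simp_all
    have i: "integrable lborel q" "integrable lborel (\<lambda>r. r * q r)" "integrable lborel (\<lambda>r. r\<^sup>2 * q r)"
      using elim(1-3) aff(1)[of q] aff(1)[of "\<lambda>r. r * q r"] aff(1)[of "\<lambda>r. r\<^sup>2 * q r"]
      by (simp_all only: q w)
    have m: "(\<integral>r. q r \<partial>lborel) = 0" "(\<integral>r. r * q r \<partial>lborel) = 0"
      using elim(4-5) aff(2)[of q] aff(2)[of "\<lambda>r. r * q r"] by (simp_all only: q w)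
    let ?I = "{r. x - (x \<bullet> w) *\<^sub>R g + r *\<^sub>R g \<in> A}"
    have pos': "0 \<le> q r" if "r \<in> ?I" for r
      unfolding q_def f_def using that by (intro mult_nonneg_nonneg pos less_imp_le[OF p_pos]) simp
    have neg': "q r \<le> 0" if "r \<notin> ?I" for r
      unfolding q_def f_def using that by (intro mult_nonpos_nonneg neg less_imp_le[OF p_pos]) simp
    obtain a b c where abc: "c \<ge> 0" "\<forall>r. q r * (a + b * r + c * r\<^sup>2) \<le> 0"
        "finite {r. a + b * r + c * r\<^sup>2 = 0}"
      by (rule interval_sign_polynomial[where I="?I" and q=q, OF I pos' neg']) (assumption | rule that)+
    have S: "S x = (\<integral>r. r\<^sup>2 * q r \<partial>lborel)"
      unfolding S_def q w by (rule aff(2)[of "\<lambda>r. r\<^sup>2 * q r"])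
    have "AE r in lborel. f (x + r *\<^sub>R g) = 0" if "S x = 0"
    proof -
      have "AE r in lborel. q r = 0"
        using sign_polynomial_second_moment(2)[OF i m abc] that S by simp
      \<comment> \<open>An almost-everywhere statement is carried through the shift of r by way of
        the integral of the absolute value, to which \<open>aff\<close> applies.\<close>
      then have "(\<integral>r. \<bar>q r\<bar> \<partial>lborel) = 0" by (intro integral_eq_zero_AE) auto
      then have "(\<integral>r. \<bar>q (x \<bullet> w + r)\<bar> \<partial>lborel) = 0" by (simp add: aff(2)[of "\<lambda>r. \<bar>q r\<bar>"])
      then have "AE r in lborel. \<bar>q (x \<bullet> w + r)\<bar> = 0"
        using elim(1) unfolding q by (subst (asm) integral_nonneg_eq_0_iff_AE) auto
      then show ?thesis unfolding q by simp
    qed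
    then show ?case
      using sign_polynomial_second_moment(1)[OF i m abc] S by simp
  qed
  let ?k = std_normal_density
  have k: "?k y > 0" for y by (simp add: normal_density_pos)
  have "AE x in lborel. 0 \<le> - (?k (x \<bullet> w) * S x)"
    using line by eventually_elim (use k in \<open>simp add: mult_nonneg_nonpos less_imp_le\<close>)
  moreover have iS: "integrable lborel (\<lambda>x. ?k (x \<bullet> w) * S x)"
    unfolding S_def by (rule integrable_line_integral[OF exp_integrable_integrable[OF f2] wg])
  \<comment> \<open>The total second moment is nonnegative by \<open>moments(3)\<close> at u = 0,
    while \<open>line\<close> makes the integrand nonpositive almost everywhere. Hence S vanishes
    almost everywhere.\<close>
  moreover have "(\<integral>x. ?k (x \<bullet> w) * S x \<partial>lborel) \<ge> 0"
    unfolding S_def integral_line_integral[OF exp_integrable_integrable[OF f2] wg]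
    using moments(3)[of 0] by simp
  then have "(\<integral>x. - (?k (x \<bullet> w) * S x) \<partial>lborel) = 0"
    using integral_nonneg_AE[OF calculation(1)] by simp
  ultimately have "AE x in lborel. - (?k (x \<bullet> w) * S x) = 0"
    by (subst (asm) integral_nonneg_eq_0_iff_AE) auto
  with line have "AE x in lborel. (\<integral>r. \<bar>f (x + r *\<^sub>R g)\<bar> \<partial>lborel) = 0"
  proof eventually_elim
    case (elim x)
    then have "AE r in lborel. f (x + r *\<^sub>R g) = 0" using k[of "x \<bullet> w"] by simp
    then show ?case by (intro integral_eq_zero_AE) auto
  qed
  \<comment> \<open>The weighted decomposition, now for the absolute value of f, leads from almost
    every line back to almost every point.\<close>
  then have "(\<integral>x. ?k (x \<bullet> w) * (\<integral>r. \<bar>f (x + r *\<^sub>R g)\<bar> \<partial>lborel) \<partial>lborel) = 0"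
    by (intro integral_eq_zero_AE) auto
  moreover have fi: "integrable lborel (\<lambda>x. \<bar>f x\<bar>)"
    using exp_integrable_integrable[OF f] by simp
  ultimately have "AE x in lborel. \<bar>f x\<bar> = 0"
    using integral_line_integral[OF fi wg] integral_nonneg_eq_0_iff_AE[OF fi] by simp
  then show ?thesis
  proof eventually_elim
    case (elim x)
    then show ?case using p_pos[of x] by (simp add: f_def)
  qed
qed

section \<open>Positive definite matrices and the normal law\<close>

lemma pos_def_matrix_inv:
  fixes \<Sigma> :: "real^'n^'n"
  assumes "pos_def_matrix \<Sigma>"
  shows "\<Sigma> ** matrix_inv \<Sigma> = mat 1" "matrix_inv \<Sigma> ** \<Sigma> = mat 1" "pos_def_matrix (matrix_inv \<Sigma>)"
proof -
  have sym: "transpose \<Sigma> = \<Sigma>" and pos: "x \<noteq> 0 \<Longrightarrow> x \<bullet> (\<Sigma> *v x) > 0" for x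
    using assms by (auto simp: pos_def_matrix_def)
  have "\<forall>x. \<Sigma> *v x = 0 \<longrightarrow> x = 0"
    using pos by force
  then have "invertible \<Sigma>"
    by (simp add: invertible_left_inverse matrix_left_invertible_ker)
  then show r: "\<Sigma> ** matrix_inv \<Sigma> = mat 1" and l: "matrix_inv \<Sigma> ** \<Sigma> = mat 1"
    unfolding invertible_def matrix_inv_def by (rule someI2_ex, simp)+
  have "transpose (matrix_inv \<Sigma>) ** \<Sigma> = mat 1"
    using arg_cong[OF r, of transpose] by (simp add: matrix_transpose_mul sym transpose_mat)
  then have "transpose (matrix_inv \<Sigma>) = matrix_inv \<Sigma>"
    by (metis r matrix_mul_assoc matrix_mul_lid matrix_mul_rid)
  moreover have "x \<bullet> (matrix_inv \<Sigma> *v x) > 0" if "x \<noteq> 0" for x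
  proof -
    let ?y = "matrix_inv \<Sigma> *v x"
    have x: "\<Sigma> *v ?y = x" by (simp add: matrix_vector_mul_assoc r)
    then have "?y \<noteq> 0" using that by auto
    then show ?thesis using pos[of ?y] by (simp add: x inner_commute)
  qed
  ultimately show "pos_def_matrix (matrix_inv \<Sigma>)" by (simp add: pos_def_matrix_def)
qed

text \<open>The quadratic form attains a positive minimum on the compact unit sphere; homogeneity
  extends the bound to all x.\<close>

lemma pos_def_matrix_lower_bound:
  fixes A :: "real^'n^'n"
  assumes "pos_def_matrix A"
  obtains c where "c > 0" "\<forall>x. c * (norm x)\<^sup>2 \<le> x \<bullet> (A *v x)"
proof -
  have "continuous_on (sphere 0 1) (\<lambda>x. x \<bullet> (A *v x))"
    by (intro continuous_intros linear_continuous_on matrix_vector_mul_bounded_linear)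
  moreover have "sphere (0 :: real^'n) 1 \<noteq> {}" by simp
  ultimately obtain e where e: "e \<in> sphere 0 1" "\<And>y. y \<in> sphere 0 1 \<Longrightarrow> e \<bullet> (A *v e) \<le> y \<bullet> (A *v y)"
    using continuous_attains_inf[of "sphere 0 1" "\<lambda>x. x \<bullet> (A *v x)"] by (auto simp: compact_sphere)
  show ?thesis
  proof (rule that)
    have "e \<noteq> 0" using e(1) by auto
    then show "e \<bullet> (A *v e) > 0" using assms unfolding pos_def_matrix_def by blast
    show "\<forall>x. e \<bullet> (A *v e) * (norm x)\<^sup>2 \<le> x \<bullet> (A *v x)"
    proof
      fix x
      show "e \<bullet> (A *v e) * (norm x)\<^sup>2 \<le> x \<bullet> (A *v x)"
      proof (cases "x = 0")
        case False
        let ?y = "(1 / norm x) *\<^sub>R x"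
        have "e \<bullet> (A *v e) \<le> ?y \<bullet> (A *v ?y)" using False by (intro e(2)) simp
        also have "\<dots> = (x \<bullet> (A *v x)) / (norm x)\<^sup>2"
          by (simp add: matrix_vector_mult_scaleR power2_eq_square)
        finally show ?thesis using False by (simp add: field_simps)
      qed simp
    qed
  qed
qed

lemma integrable_exp_norm_square:
  fixes a :: real
  assumes "a > 0"
  shows "integrable lborel (\<lambda>x :: 'a::euclidean_space. exp (- a * (norm x)\<^sup>2))"
proof (rule integrableI_bounded)
  \<comment> \<open>The standard deviation for which \<open>exp (- a * t\<^sup>2)\<close> is an
    unnormalised normal density; the integral over the space factors over the coordinates.\<close>
  define \<sigma> where "\<sigma> = 1 / sqrt (2 * a)"
  have \<sigma>: "\<sigma> > 0" "a = 1 / (2 * \<sigma>\<^sup>2)" using assms by (auto simp: \<sigma>_def power_divide)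
  have e: "exp (- a * t\<^sup>2) = sqrt (2 * pi * \<sigma>\<^sup>2) * normal_density 0 \<sigma> t" for t
    using \<sigma> by (simp add: normal_density_def field_simps)
  have "integrable lborel (\<lambda>t. exp (- a * t\<^sup>2))"
    unfolding e using \<sigma>(1) by simp
  then have fin: "(\<integral>\<^sup>+t. ennreal (exp (- a * t\<^sup>2)) \<partial>lborel) < \<infinity>"
    by (simp add: integrable_iff_bounded)
  have "(\<integral>\<^sup>+(x::'a). ennreal (norm (exp (- a * (norm x)\<^sup>2))) \<partial>lborel) =
    (\<integral>\<^sup>+(x::'a). (\<Prod>b\<in>Basis. ennreal (exp (- a * (x \<bullet> b)\<^sup>2))) \<partial>lborel)"
  proof (rule nn_integral_cong)
    fix x :: 'a
    have "(norm x)\<^sup>2 = (\<Sum>b\<in>Basis. (x \<bullet> b)\<^sup>2)"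
      unfolding power2_norm_eq_inner by (subst euclidean_inner) (simp add: power2_eq_square)
    then show "ennreal (norm (exp (- a * (norm x)\<^sup>2))) = (\<Prod>b\<in>Basis. ennreal (exp (- a * (x \<bullet> b)\<^sup>2)))"
      by (simp add: prod_ennreal sum_distrib_left exp_sum abs_prod flip: sum_negf)
  qed
  also have "\<dots> = (\<Prod>b\<in>(Basis::'a set). \<integral>\<^sup>+t. ennreal (exp (- a * t\<^sup>2)) \<partial>lborel)"
    by (rule nn_integral_lborel_prod) auto
  also have "\<dots> < \<infinity>" using fin by (simp add: power_less_top_ennreal)
  finally show "(\<integral>\<^sup>+(x::'a). ennreal (norm (exp (- a * (norm x)\<^sup>2))) \<partial>lborel) < \<infinity>" .
qed measurable

lemma exp_integrable_gaussian:
  fixes A :: "real^'n^'n"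
  assumes "pos_def_matrix A"
  shows "exp_integrable (\<lambda>x. exp (- (x \<bullet> (A *v x)) / 2))"
  unfolding exp_integrable_def
proof (intro conjI allI)
  show m: "(\<lambda>x. exp (- (x \<bullet> (A *v x)) / 2)) \<in> borel_measurable borel"
    by (intro borel_measurable_continuous_onI continuous_intros linear_continuous_on
        matrix_vector_mul_bounded_linear) simp
  obtain c where c: "c > 0" "\<forall>x. c * (norm x)\<^sup>2 \<le> x \<bullet> (A *v x)"
    using pos_def_matrix_lower_bound[OF assms] .
  fix s
  \<comment> \<open>Half of the Gaussian decay absorbs the weight: completing the square bounds
    \<open>s * norm x\<close> by \<open>s\<^sup>2 / c + c / 4 * (norm x)\<^sup>2\<close>, leaving c
    / 4 of the available c / 2.\<close>
  have i: "integrable lborel (\<lambda>x :: real^'n. exp (s\<^sup>2 / c) * exp (- (c / 4) * (norm x)\<^sup>2))"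
    using c by (intro integrable_mult_right integrable_exp_norm_square) simp
  show "integrable lborel (\<lambda>x. exp (s * norm x) * exp (- (x \<bullet> (A *v x)) / 2))"
  proof (rule Bochner_Integration.integrable_bound[OF i])
    show "AE x in lborel. norm (exp (s * norm x) * exp (- (x \<bullet> (A *v x)) / 2)) \<le>
      norm (exp (s\<^sup>2 / c) * exp (- (c / 4) * (norm x)\<^sup>2))"
    proof (rule AE_I2)
      fix x :: "real^'n"
      have "0 \<le> (s - c / 2 * norm x)\<^sup>2 / c" using c by simp
      also have "\<dots> = s\<^sup>2 / c - s * norm x + c / 4 * (norm x)\<^sup>2"
        using c by (simp add: power2_eq_square field_simps)
      finally show "norm (exp (s * norm x) * exp (- (x \<bullet> (A *v x)) / 2)) \<le>
          norm (exp (s\<^sup>2 / c) * exp (- (c / 4) * (norm x)\<^sup>2))"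
        using c(2)[rule_format, of x] by (simp flip: exp_add)
    qed
  qed (use m in measurable)
qed

text \<open>Expanding the quadratic form exhibits the exponential family: x and \<open>\<mu>\<close>
  interact only through the natural parameter \<open>matrix_inv \<Sigma> *v \<mu>\<close>, and the
  factor in front is positive.\<close>

lemma expect_mvn_eq:
  fixes \<Sigma> :: "real^'n^'n" and \<mu> :: "real^'n"
  assumes \<Sigma>: "pos_def_matrix \<Sigma>" and K: "det \<Sigma> > 0"
    and [measurable]: "\<phi> \<in> borel_measurable borel"
  shows "expect_mvn \<mu> \<Sigma> \<phi> =
    exp (- (\<mu> \<bullet> (matrix_inv \<Sigma> *v \<mu>)) / 2) / sqrt ((2 * pi) ^ CARD('n) * det \<Sigma>) *
    (\<integral>x. \<phi> x * exp (- (x \<bullet> (matrix_inv \<Sigma> *v x)) / 2) * exp (x \<bullet> (matrix_inv \<Sigma> *v \<mu>)) \<partial>lborel)"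
proof -
  let ?S = "matrix_inv \<Sigma>" and ?K = "sqrt ((2 * pi) ^ CARD('n) * det \<Sigma>)"
  have sym: "transpose ?S = ?S" using pos_def_matrix_inv(3)[OF \<Sigma>] by (simp add: pos_def_matrix_def)
  have e: "(x - \<mu>) \<bullet> (?S *v (x - \<mu>)) = x \<bullet> (?S *v x) - 2 * (x \<bullet> (?S *v \<mu>)) + \<mu> \<bullet> (?S *v \<mu>)" for x
  proof -
    have "\<mu> \<bullet> (?S *v x) = x \<bullet> (?S *v \<mu>)"
      by (metis dot_lmul_matrix inner_commute sym transpose_matrix_vector)
    then show ?thesis
      by (simp add: matrix_vector_mult_diff_distrib inner_diff_left inner_diff_right)
  qed
  have d: "mvn_density \<mu> \<Sigma> x = exp (- (\<mu> \<bullet> (?S *v \<mu>)) / 2) / ?K *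
      (exp (- (x \<bullet> (?S *v x)) / 2) * exp (x \<bullet> (?S *v \<mu>)))" for x
  proof -
    have "exp (- (a - 2 * b + m) / 2) = exp (- m / 2) * (exp (- a / 2) * exp b)" for a b m :: real
      by (simp add: exp_add[symmetric] field_simps)
    then show ?thesis unfolding mvn_density_def e by simp
  qed
  have m: "mvn_density \<mu> \<Sigma> \<in> borel_measurable borel"
    unfolding d[abs_def] by (intro borel_measurable_continuous_onI continuous_intros linear_continuous_on
        matrix_vector_mul_bounded_linear) (use K in simp_all)
  have "expect_mvn \<mu> \<Sigma> \<phi> = (\<integral>x. mvn_density \<mu> \<Sigma> x * \<phi> x \<partial>lborel)"
    unfolding expect_mvn_def mvn_def
    by (subst integral_density) (use m K in \<open>auto simp: mvn_density_def\<close>)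
  then show ?thesis by (simp add: d mult_ac flip: integral_mult_right_zero)
qed

text \<open>For a competitor \<open>\<phi>'\<close> the difference
  \<open>D = \<phi>' - \<phi>\<close> is nonnegative where the 0-1 test \<open>\<phi>\<close>
  accepts and nonpositive where it rejects. Once D = 0 almost everywhere, all powers agree and no
  improvement is strict.\<close>

lemma interval_sections_admissible:
  fixes \<Sigma> :: "real^'n^'n"
  assumes \<Sigma>: "pos_def_matrix \<Sigma>"
    and \<phi>[measurable]: "\<phi> \<in> borel_measurable borel" and \<phi>01: "\<And>x. \<phi> x = 0 \<or> \<phi> x = 1"
    and I: "\<And>x. is_interval {r. \<phi> (x + r *\<^sub>R column i \<Sigma>) = 0}"
  shows "admissible \<Sigma> i \<phi>"
  unfolding admissible_def
proof
  let ?S = "matrix_inv \<Sigma>" and ?E = "\<lambda>\<mu>. expect_mvn \<mu> \<Sigma>" and ?g = "column i \<Sigma>"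
  define p where "p x = exp (- (x \<bullet> (?S *v x)) / 2)" for x
  assume "\<exists>\<phi>'. is_test \<phi>' \<and> (\<forall>\<mu>. \<mu> $ i = 0 \<longrightarrow> ?E \<mu> \<phi>' \<le> ?E \<mu> \<phi>) \<and>
     (\<forall>\<mu>. \<mu> $ i \<noteq> 0 \<longrightarrow> ?E \<mu> \<phi>' \<ge> ?E \<mu> \<phi>) \<and>
     (\<exists>\<mu>. (\<mu> $ i = 0 \<and> ?E \<mu> \<phi>' < ?E \<mu> \<phi>) \<or> (\<mu> $ i \<noteq> 0 \<and> ?E \<mu> \<phi>' > ?E \<mu> \<phi>))"
  then obtain \<phi>' where test: "is_test \<phi>'"
    and null: "\<And>\<mu>. \<mu> $ i = 0 \<Longrightarrow> ?E \<mu> \<phi>' \<le> ?E \<mu> \<phi>"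
    and alt: "\<And>\<mu>. \<mu> $ i \<noteq> 0 \<Longrightarrow> ?E \<mu> \<phi>' \<ge> ?E \<mu> \<phi>"
    and strict: "\<exists>\<mu>. ?E \<mu> \<phi>' \<noteq> ?E \<mu> \<phi>"
    by (metis less_irrefl)
  have [measurable]: "\<phi>' \<in> borel_measurable borel" and \<phi>': "0 \<le> \<phi>' x" "\<phi>' x \<le> 1" for x
    using test by (auto simp: is_test_def)
  \<comment> \<open>Otherwise the junk value of the density is nonpositive and every \<open>mvn \<mu> \<Sigma>\<close> is null.\<close>
  have K: "det \<Sigma> > 0"
  proof (rule ccontr)
    assume "\<not> det \<Sigma> > 0"
    then have "sqrt ((2 * pi) ^ CARD('n) * det \<Sigma>) \<le> 0" by (simp add: mult_le_0_iff)
    then have "mvn_density \<mu> \<Sigma> x \<le> 0" for \<mu> x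
      by (simp add: mvn_density_def divide_nonneg_nonpos)
    then have mvn0: "mvn \<mu> \<Sigma> = density lborel (\<lambda>_. 0)" for \<mu>
      unfolding mvn_def by (intro arg_cong[of _ _ "density lborel"] ext) (simp add: ennreal_neg)
    have "?E \<mu> f = 0" for \<mu> f
      unfolding expect_mvn_def mvn0
      by (intro integral_eq_zero_AE) (simp add: AE_density)
    then show False using strict by simp
  qed
  define D where "D x = \<phi>' x - \<phi> x" for x
  have D: "D \<in> borel_measurable borel" unfolding D_def by measurable
  have D1: "\<bar>D x\<bar> \<le> 1" for x using \<phi>01[of x] \<phi>'[of x] by (auto simp: D_def)
  have p: "exp_integrable p"
    unfolding p_def by (rule exp_integrable_gaussian[OF pos_def_matrix_inv(3)[OF \<Sigma>]])
  have diff: "\<exists>c>0. ?E \<mu> \<phi>' - ?E \<mu> \<phi> = c * (\<integral>x. D x * p x * exp (x \<bullet> (?S *v \<mu>)) \<partial>lborel)" for \<mu>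
  proof -
    let ?c = "exp (- (\<mu> \<bullet> (?S *v \<mu>)) / 2) / sqrt ((2 * pi) ^ CARD('n) * det \<Sigma>)"
    have i: "integrable lborel (\<lambda>x. f x * p x * exp (x \<bullet> (?S *v \<mu>)))"
      if "f \<in> borel_measurable borel" "\<And>x. \<bar>f x\<bar> \<le> 1" for f
      using exp_integrable_integrable[OF exp_integrable_exp[OF exp_integrable_bounded[OF p that]]]
      by (simp add: mult_ac)
    have \<phi>1: "\<bar>\<phi> x\<bar> \<le> 1" for x using \<phi>01[of x] by auto
    have "?E \<mu> \<phi>' - ?E \<mu> \<phi> = ?c * ((\<integral>x. \<phi>' x * p x * exp (x \<bullet> (?S *v \<mu>)) \<partial>lborel) -
        (\<integral>x. \<phi> x * p x * exp (x \<bullet> (?S *v \<mu>)) \<partial>lborel))"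
      by (simp add: expect_mvn_eq[OF \<Sigma> K] p_def right_diff_distrib)
    also have "\<dots> = ?c * (\<integral>x. \<phi>' x * p x * exp (x \<bullet> (?S *v \<mu>)) - \<phi> x * p x * exp (x \<bullet> (?S *v \<mu>)) \<partial>lborel)"
      using i[of \<phi>] i[of \<phi>'] \<phi>1 \<phi>' by (subst Bochner_Integration.integral_diff) simp_all
    also have "\<dots> = ?c * (\<integral>x. D x * p x * exp (x \<bullet> (?S *v \<mu>)) \<partial>lborel)"
      by (simp add: D_def left_diff_distrib)
    finally show ?thesis using K by (intro exI[of _ ?c]) simp
  qed
  \<comment> \<open>Every u is the natural parameter of the mean \<open>\<Sigma> *v u\<close>, so
    the power conditions become sign conditions at all u.\<close>
  have eq: "\<exists>c>0. ?E (\<Sigma> *v u) \<phi>' - ?E (\<Sigma> *v u) \<phi> = c * (\<integral>x. D x * p x * exp (x \<bullet> u) \<partial>lborel)" for u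
    using diff[of "\<Sigma> *v u"] by (simp add: matrix_vector_mul_assoc pos_def_matrix_inv[OF \<Sigma>])
  have sym: "transpose \<Sigma> = \<Sigma>" using \<Sigma> by (simp add: pos_def_matrix_def)
  have ug: "u \<bullet> ?g = (\<Sigma> *v u) $ i" for u
    by (metis inner_commute matrix_vector_mul_component row_transpose sym row_def vec_nth_inverse)
  have "axis i 1 \<noteq> (0 :: real^'n)" by (simp add: axis_eq_0_iff)
  then have "axis i 1 \<bullet> (\<Sigma> *v axis i 1) > 0" using \<Sigma> by (simp add: pos_def_matrix_def)
  then have g: "?g \<noteq> 0" using ug[of "axis i 1"] by (auto simp: inner_axis')
  have "AE x in lborel. D x = 0"
  proof (rule interval_sections_unbeatable[OF p _ D D1 g, where A="{x. \<phi> x = 0}"])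
    show "p x > 0" for x by (simp add: p_def)
    fix u
    obtain c where c: "c > 0" "?E (\<Sigma> *v u) \<phi>' - ?E (\<Sigma> *v u) \<phi> = c * (\<integral>x. D x * p x * exp (x \<bullet> u) \<partial>lborel)"
      using eq by blast
    show "(\<integral>x. D x * p x * exp (x \<bullet> u) \<partial>lborel) \<le> 0" if "u \<bullet> ?g = 0"
    proof -
      have "c * (\<integral>x. D x * p x * exp (x \<bullet> u) \<partial>lborel) \<le> 0"
        using null[of "\<Sigma> *v u"] that c(2) ug by simp
      then show ?thesis using c(1) by (simp add: mult_le_0_iff)
    qed
    show "(\<integral>x. D x * p x * exp (x \<bullet> u) \<partial>lborel) \<ge> 0" if "u \<bullet> ?g \<noteq> 0"
    proof -
      have "0 \<le> c * (\<integral>x. D x * p x * exp (x \<bullet> u) \<partial>lborel)"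
        using alt[of "\<Sigma> *v u"] that c(2) ug by simp
      then show ?thesis using c(1) by (simp add: zero_le_mult_iff)
    qed
  next
    fix x
    show "is_interval {r. x + r *\<^sub>R ?g \<in> {x. \<phi> x = 0}}" using I by simp
    show "0 \<le> D x" if "x \<in> {x. \<phi> x = 0}" using that \<phi>' by (simp add: D_def)
    show "D x \<le> 0" if "x \<notin> {x. \<phi> x = 0}" using that \<phi>' \<phi>01[of x] by (simp add: D_def)
  qed
  then have "?E \<mu> \<phi>' = ?E \<mu> \<phi>" for \<mu>
  proof -
    have "(\<integral>x. D x * p x * exp (x \<bullet> (?S *v \<mu>)) \<partial>lborel) = 0"
      using \<open>AE x in lborel. D x = 0\<close> by (intro integral_eq_zero_AE) auto
    then show ?thesis using diff[of \<mu>] by auto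
  qed
  then show False using strict by blast
qed

section \<open>Acceptance regions of the step-down procedure\<close>

text \<open>Ties are resolved inside the order, as in \<open>max_abs_index\<close>, so that it is
  total and holds for every x, not just almost every x.\<close>

definition abs_precedes :: "real^'n::{finite,linorder} \<Rightarrow> 'n \<Rightarrow> 'n \<Rightarrow> bool" where
  "abs_precedes x j k \<longleftrightarrow> \<bar>x $ k\<bar> < \<bar>x $ j\<bar> \<or> \<bar>x $ k\<bar> = \<bar>x $ j\<bar> \<and> j < k"

text \<open>Initial segments of this order: the candidates for the set of hypotheses rejected so
  far, described without running the procedure.\<close>

definition abs_upper_set :: "real^'n::{finite,linorder} \<Rightarrow> 'n set \<Rightarrow> bool" where
  "abs_upper_set x J \<longleftrightarrow> (\<forall>j\<in>J. \<forall>k. k \<notin> J \<longrightarrow> abs_precedes x j k)"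

text \<open>The order of rejection if every stage were to reject. It is meaningful for m up to
  \<open>CARD('n)\<close>; beyond that no index is left to choose.\<close>

primrec max_abs_prefix :: "real^'n::{finite,linorder} \<Rightarrow> nat \<Rightarrow> 'n list" where
  "max_abs_prefix x 0 = []"
| "max_abs_prefix x (Suc m) = max_abs_prefix x m @ [max_abs_index (set (max_abs_prefix x m)) x]"

lemma abs_precedes_asym: "abs_precedes x j k \<Longrightarrow> \<not> abs_precedes x k j"
  by (auto simp: abs_precedes_def)

lemma abs_precedes_trans: "abs_precedes x j k \<Longrightarrow> abs_precedes x k l \<Longrightarrow> abs_precedes x j l"
  by (auto simp: abs_precedes_def)

lemma abs_precedes_total: "j \<noteq> k \<Longrightarrow> abs_precedes x j k \<or> abs_precedes x k j"
  by (auto simp: abs_precedes_def)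

lemma max_abs_index:
  fixes x :: "real^'n::{finite,linorder}"
  assumes "J \<noteq> UNIV"
  shows "max_abs_index J x \<notin> J"
    and "k \<notin> J \<Longrightarrow> k \<noteq> max_abs_index J x \<Longrightarrow> abs_precedes x (max_abs_index J x) k"
proof -
  let ?T = "{j. j \<notin> J \<and> (\<forall>k. k \<notin> J \<longrightarrow> \<bar>x $ k\<bar> \<le> \<bar>x $ j\<bar>)}"
  have "Max ((\<lambda>k. \<bar>x $ k\<bar>) ` (- J)) \<in> (\<lambda>k. \<bar>x $ k\<bar>) ` (- J)"
    using assms by (intro Max_in) auto
  then obtain j where "j \<notin> J" "\<bar>x $ j\<bar> = Max ((\<lambda>k. \<bar>x $ k\<bar>) ` (- J))" by auto
  then have "j \<in> ?T" by simp
  then have M: "max_abs_index J x \<in> ?T"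
    unfolding max_abs_index_def by (intro Min_in) auto
  then show "max_abs_index J x \<notin> J" by simp
  assume k: "k \<notin> J" "k \<noteq> max_abs_index J x"
  show "abs_precedes x (max_abs_index J x) k"
  proof (cases "\<bar>x $ k\<bar> = \<bar>x $ max_abs_index J x\<bar>")
    case True
    then have "k \<in> ?T" using M k by simp
    then have "max_abs_index J x \<le> k" unfolding max_abs_index_def by (intro Min_le) auto
    then show ?thesis using True k by (simp add: abs_precedes_def)
  next
    case False
    then show ?thesis using M k by (force simp: abs_precedes_def)
  qed
qed

lemma length_max_abs_prefix [simp]: "length (max_abs_prefix x m) = m"
  by (induction m) auto

lemma max_abs_prefix_mono: "m \<le> n \<Longrightarrow> set (max_abs_prefix x m) \<subseteq> set (max_abs_prefix x n)"
  by (induction n) (auto simp: le_Suc_eq)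

lemma max_abs_prefix_upper_set:
  fixes x :: "real^'n::{finite,linorder}"
  assumes "m \<le> CARD('n)"
  shows "card (set (max_abs_prefix x m)) = m" "abs_upper_set x (set (max_abs_prefix x m))"
proof -
  have "card (set (max_abs_prefix x m)) = m \<and> abs_upper_set x (set (max_abs_prefix x m))"
    using assms
  proof (induction m)
    case 0
    then show ?case by (simp add: abs_upper_set_def)
  next
    case (Suc m)
    let ?J = "set (max_abs_prefix x m)"
    have IH: "card ?J = m" "abs_upper_set x ?J" using Suc by auto
    then have "?J \<noteq> UNIV" using Suc.prems by auto
    then show ?case using IH max_abs_index(1)[of ?J x] max_abs_index(2)[of ?J _ x] by (auto simp: abs_upper_set_def)
  qed
  then show "card (set (max_abs_prefix x m)) = m" "abs_upper_set x (set (max_abs_prefix x m))"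
    by blast+
qed

text \<open>If two such sets of equal size differed, each would have an element outside the other,
  and these two would precede one another.\<close>

lemma abs_upper_set_unique:
  fixes x :: "real^'n::{finite,linorder}"
  assumes "abs_upper_set x J" "abs_upper_set x J'" "card J = card J'"
  shows "J = J'"
proof (rule ccontr)
  assume "J \<noteq> J'"
  then obtain j k where "j \<in> J" "j \<notin> J'" "k \<in> J'" "k \<notin> J"
    using assms(3) card_subset_eq[of J J'] card_subset_eq[of J' J] by (auto simp: subset_iff)
  then show False
    using assms(1,2) abs_precedes_asym unfolding abs_upper_set_def by blast
qed

text \<open>The rejected list is determined by its length, so a run of the procedure reduces to
  inequalities for the stages passed.\<close>

lemma lrsd_rejects_iff:
  fixes x :: "real^'n::{finite,linorder}"
  shows "lrsd_rejects \<Sigma> C x js \<longleftrightarrow> js = max_abs_prefix x (length js) \<and> length js \<le> CARD('n) \<and>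
    (\<forall>l < length js. C (l + 1) \<le> lr_stat \<Sigma> (set (max_abs_prefix x l)) x)"
proof
  assume "lrsd_rejects \<Sigma> C x js"
  then show "js = max_abs_prefix x (length js) \<and> length js \<le> CARD('n) \<and>
      (\<forall>l < length js. C (l + 1) \<le> lr_stat \<Sigma> (set (max_abs_prefix x l)) x)"
    by induction (auto simp: less_Suc_eq)
next
  have "lrsd_rejects \<Sigma> C x (max_abs_prefix x m)"
    if "m \<le> CARD('n)" "\<forall>l < m. C (l + 1) \<le> lr_stat \<Sigma> (set (max_abs_prefix x l)) x" for m
    using that by (induction m) (auto intro: lrsd_rejects.intros)
  moreover assume "js = max_abs_prefix x (length js) \<and> length js \<le> CARD('n) \<and>
    (\<forall>l < length js. C (l + 1) \<le> lr_stat \<Sigma> (set (max_abs_prefix x l)) x)"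
  ultimately show "lrsd_rejects \<Sigma> C x js" by metis
qed

text \<open>Stages after an acceptance may be included, because an accepted hypothesis stays accepted.\<close>

lemma lrsd_test_eq_0_iff:
  fixes x :: "real^'n::{finite,linorder}"
  shows "lrsd_test \<Sigma> C i x = 0 \<longleftrightarrow>
    (\<exists>J. abs_upper_set x J \<and> i \<notin> J \<and> lr_stat \<Sigma> J x < C (card J + 1))"
proof -
  let ?P = "\<lambda>m. set (max_abs_prefix x m)"
  have "(\<exists>js. lrsd_rejects \<Sigma> C x js \<and> i \<in> set js) \<longleftrightarrow>
    (\<exists>m\<le>CARD('n). (\<forall>l<m. C (l + 1) \<le> lr_stat \<Sigma> (?P l) x) \<and> i \<in> ?P m)"
    unfolding lrsd_rejects_iff by (metis length_max_abs_prefix)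
  also have "\<dots> \<longleftrightarrow> (\<forall>m<CARD('n). i \<notin> ?P m \<longrightarrow> C (m + 1) \<le> lr_stat \<Sigma> (?P m) x)"
  proof safe
    fix m n
    assume "\<forall>l<m. C (l + 1) \<le> lr_stat \<Sigma> (?P l) x" "i \<in> ?P m" "i \<notin> ?P n"
    then show "C (n + 1) \<le> lr_stat \<Sigma> (?P n) x"
      using max_abs_prefix_mono[of m n x] by (cases "n < m") auto
  next
    assume *: "\<forall>m<CARD('n). i \<notin> ?P m \<longrightarrow> C (m + 1) \<le> lr_stat \<Sigma> (?P m) x"
    \<comment> \<open>The stage that removes i. All earlier prefixes miss i, so the assumption
      passes every stage up to it; it exists because the full prefix is everything.\<close>
    define m where "m = (LEAST m. i \<in> ?P m)"
    have "?P CARD('n) = UNIV"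
      using max_abs_prefix_upper_set(1)[of "CARD('n)" x] by (intro card_subset_eq) auto
    then have "i \<in> ?P CARD('n)" by simp
    then have m: "i \<in> ?P m" "m \<le> CARD('n)" "\<And>l. l < m \<Longrightarrow> i \<notin> ?P l"
      unfolding m_def by (auto intro: LeastI Least_le dest: not_less_Least)
    then show "\<exists>m\<le>CARD('n). (\<forall>l<m. C (l + 1) \<le> lr_stat \<Sigma> (?P l) x) \<and> i \<in> ?P m"
      using * by (intro exI[of _ m]) auto
  qed
  finally have "lrsd_test \<Sigma> C i x = 0 \<longleftrightarrow>
      (\<exists>m<CARD('n). i \<notin> ?P m \<and> lr_stat \<Sigma> (?P m) x < C (m + 1))"
    by (auto simp: lrsd_test_def not_le)
  also have "\<dots> \<longleftrightarrow> (\<exists>J. abs_upper_set x J \<and> i \<notin> J \<and> lr_stat \<Sigma> J x < C (card J + 1))"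
  proof safe
    fix m assume "m < CARD('n)" "i \<notin> ?P m" "lr_stat \<Sigma> (?P m) x < C (m + 1)"
    then show "\<exists>J. abs_upper_set x J \<and> i \<notin> J \<and> lr_stat \<Sigma> J x < C (card J + 1)"
      using max_abs_prefix_upper_set[of m x] by (intro exI[of _ "?P m"]) simp
  next
    fix J assume J: "abs_upper_set x J" "i \<notin> J" "lr_stat \<Sigma> J x < C (card J + 1)"
    have c: "card J < CARD('n)" using J(2) by (intro psubset_card_mono) auto
    have "?P (card J) = J"
      using max_abs_prefix_upper_set[of "card J" x] c J(1) by (intro abs_upper_set_unique) auto
    then show "\<exists>m<CARD('n). i \<notin> ?P m \<and> lr_stat \<Sigma> (?P m) x < C (m + 1)"
      using c J by (intro exI[of _ "card J"]) simp
  qed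
  finally show ?thesis .
qed

section \<open>Deletion of coordinates and the likelihood ratio statistics\<close>

lemma del_mat_1: "del_mat J (mat 1) $ i $ k = (if i = k then if i \<in> J then 0 else 1 else (0::real))"
  by (simp add: del_mat_def mat_def)

text \<open>Deletion is multiplication by the coordinate projection
  \<open>del_mat J (mat 1)\<close>, which turns the facts about submatrices into matrix
  algebra.\<close>

lemma del_vec_eq: "del_vec J x = del_mat J (mat 1) *v x"
  by (simp add: vec_eq_iff del_vec_def matrix_vector_mult_def del_mat_1 mult_delta_left)

lemma del_mat_eq: "del_mat J A = del_mat J (mat 1) ** A ** del_mat J (mat 1)"
  by (simp add: vec_eq_iff del_mat_def[of J A] matrix_matrix_mult_def del_mat_1 mult_delta_left mult_delta_right)

lemma lr_stat_measurable [measurable]: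
  fixes \<Sigma> :: "real^'n^'n"
  shows "lr_stat \<Sigma> J \<in> borel_measurable borel"
  unfolding lr_stat_def[abs_def] del_vec_eq matrix_vector_mul_assoc
  by (intro borel_measurable_continuous_onI continuous_intros linear_continuous_on
      matrix_vector_mul_bounded_linear)

lemma lrsd_test_cases: "lrsd_test \<Sigma> C i x = 0 \<or> lrsd_test \<Sigma> C i x = 1"
  by (simp add: lrsd_test_def)

lemma lrsd_test_measurable:
  fixes \<Sigma> :: "real^'n::{finite,linorder}^'n::{finite,linorder}"
  shows "lrsd_test \<Sigma> C i \<in> borel_measurable borel"
proof -
  have [measurable]: "(\<lambda>x :: real^'n::{finite,linorder}. x $ k) \<in> borel_measurable borel" for k
    by (intro borel_measurable_continuous_onI continuous_intros)
  have [measurable]: "Measurable.pred borel (\<lambda>x. abs_upper_set x J)" for J :: "'n set"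
    unfolding abs_upper_set_def abs_precedes_def by measurable
  have e: "lrsd_test \<Sigma> C i x =
      (if \<exists>J\<in>UNIV. abs_upper_set x J \<and> i \<notin> J \<and> lr_stat \<Sigma> J x < C (card J + 1) then 0 else 1)" for x
    using lrsd_test_eq_0_iff[of \<Sigma> C i x] lrsd_test_cases[of \<Sigma> C i x] by auto
  have [measurable]: "Measurable.pred borel
      (\<lambda>x. \<exists>J\<in>UNIV. abs_upper_set x J \<and> i \<notin> J \<and> lr_stat \<Sigma> J x < C (card J + 1))"
    by (rule pred_intros_finite) simp_all
  show ?thesis unfolding e[abs_def] by measurable
qed

text \<open>Justifies the definite description. A solution is the inverse V of \<open>?W\<close>
  compressed to the kept coordinates; uniqueness is the usual argument for two-sided inverses, with
  \<open>?E\<close> as unit.\<close>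

lemma del_inv:
  fixes \<Sigma> :: "real^'n^'n"
  assumes "pos_def_matrix \<Sigma>"
  shows "del_mat J (del_inv J \<Sigma>) = del_inv J \<Sigma>"
    and "del_mat J \<Sigma> ** del_inv J \<Sigma> = del_mat J (mat 1)"
    and "del_inv J \<Sigma> ** del_mat J \<Sigma> = del_mat J (mat 1)"
proof -
  let ?E = "del_mat J (mat 1) :: real^'n^'n"
  let ?A = "del_mat J \<Sigma>"
  \<comment> \<open>Adding the identity on the deleted coordinates makes the deleted matrix invertible.\<close>
  let ?W = "?A + (mat 1 - ?E)"
  have EE: "?E ** ?E = ?E" using del_mat_eq[of J "mat 1 :: real^'n^'n"] by simp
  have tE: "transpose ?E = ?E" by (simp add: vec_eq_iff transpose_def del_mat_def mat_def)
  have AE: "?A ** ?E = ?A" by (subst (1 2) del_mat_eq) (simp add: EE flip: matrix_mul_assoc)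
  have EA: "?E ** ?A = ?A" by (subst (1 2) del_mat_eq) (simp add: EE matrix_mul_assoc)
  have v: "?E *v (?E *v x) = ?E *v x" "?A *v (?E *v x) = ?A *v x" "?E *v (?A *v x) = ?A *v x" for x
    by (simp_all add: matrix_vector_mul_assoc EE AE EA)
  have WE: "?W ** ?E = ?A" and EW: "?E ** ?W = ?A"
    by (simp_all add: matrix_eq v matrix_vector_mult_add_rdistrib matrix_vector_mult_diff_rdistrib
        matrix_vector_right_distrib matrix_vector_mult_diff_distrib flip: matrix_vector_mul_assoc)
  \<comment> \<open>x splits orthogonally into \<open>?E *v x\<close> and the rest. The form of
    \<open>?W\<close> at x is the form of \<open>\<Sigma>\<close> at the first part plus the squared
    norm of the second, so both parts vanish.\<close>
  have inj: "x = 0" if "?W *v x = 0" for x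
  proof -
    have adj: "x \<bullet> (?E *v y) = (?E *v x) \<bullet> y" for y
      by (metis dot_lmul_matrix tE transpose_matrix_vector)
    have A: "?A *v x = ?E *v (\<Sigma> *v (?E *v x))"
      by (subst del_mat_eq) (simp add: matrix_vector_mul_assoc matrix_mul_assoc)
    have "(?E *v x) \<bullet> (x - ?E *v x) = 0"
      unfolding adj[symmetric] by (simp add: matrix_vector_mult_diff_distrib v)
    then have "(x - ?E *v x) \<bullet> (x - ?E *v x) = x \<bullet> (x - ?E *v x)"
      by (simp only: inner_diff_left)
    moreover have "x \<bullet> (?W *v x) = x \<bullet> (?A *v x) + x \<bullet> (x - ?E *v x)"
      by (simp only: matrix_vector_mult_add_rdistrib matrix_vector_mult_diff_rdistrib
          inner_add_right matrix_vector_mul_lid)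
    ultimately have "(?E *v x) \<bullet> (\<Sigma> *v (?E *v x)) + (x - ?E *v x) \<bullet> (x - ?E *v x) = x \<bullet> (?W *v x)"
      by (simp only: A adj)
    then have s: "(?E *v x) \<bullet> (\<Sigma> *v (?E *v x)) + (x - ?E *v x) \<bullet> (x - ?E *v x) = 0" using that by simp
    have "0 \<le> (?E *v x) \<bullet> (\<Sigma> *v (?E *v x))"
      using assms by (cases "?E *v x = 0") (auto simp: pos_def_matrix_def less_imp_le)
    then have "(?E *v x) \<bullet> (\<Sigma> *v (?E *v x)) = 0" "(x - ?E *v x) \<bullet> (x - ?E *v x) = 0"
      using s inner_ge_zero[of "x - ?E *v x"] by linarith+
    then show "x = 0" using assms unfolding pos_def_matrix_def by (metis eq_iff_diff_eq_0 inner_eq_zero_iff less_irrefl)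
  qed
  then have "invertible ?W"
    unfolding invertible_left_inverse matrix_left_invertible_ker by blast
  then obtain V where V: "?W ** V = mat 1" "V ** ?W = mat 1" unfolding invertible_def by blast
  \<comment> \<open>V inherits commutation with \<open>?E\<close> from its inverse
    \<open>?W\<close>.\<close>
  have EV: "?E ** V = V ** ?E"
  proof -
    have "?E ** V = V ** ?W ** ?E ** V" by (simp add: V)
    also have "\<dots> = V ** (?E ** ?W) ** V" by (simp add: WE EW flip: matrix_mul_assoc)
    also have "\<dots> = V ** ?E" by (simp add: V flip: matrix_mul_assoc)
    finally show ?thesis .
  qed
  let ?P = "\<lambda>B. del_mat J B = B \<and> ?A ** B = ?E \<and> B ** ?A = ?E"
  have "?P (?E ** V)"
  proof (intro conjI)
    show "del_mat J (?E ** V) = ?E ** V"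
      by (subst del_mat_eq) (metis EE EV matrix_mul_assoc)
    show "?A ** (?E ** V) = ?E"
      by (metis AE EW V(1) matrix_mul_assoc matrix_mul_rid)
    show "?E ** V ** ?A = ?E"
      by (metis EA EV WE V(2) matrix_mul_assoc matrix_mul_lid)
  qed
  moreover have "B = B'" if B: "?P B" and B': "?P B'" for B B'
  proof -
    have "B = B ** ?E" using B del_mat_eq[of J B] by (metis EE matrix_mul_assoc)
    also have "\<dots> = B ** ?A ** B'" using B' by (simp flip: matrix_mul_assoc)
    also have "\<dots> = ?E ** B'" using B by simp
    also have "\<dots> = B'" using B' del_mat_eq[of J B'] by (metis EE matrix_mul_assoc)
    finally show ?thesis .
  qed
  ultimately have "?P (del_inv J \<Sigma>)"
    unfolding del_inv_def by (intro theI[of ?P]) blast+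
  then show "del_mat J (del_inv J \<Sigma>) = del_inv J \<Sigma>" "?A ** del_inv J \<Sigma> = ?E" "del_inv J \<Sigma> ** ?A = ?E"
    by blast+
qed

text \<open>Since i is kept, the deleted column is \<open>?A *v ?e\<close>, and \<open>?B\<close>
  cancels \<open>?A\<close>. The dependence on r is therefore the same for all J that omit i, which
  allows statistics for different J to be compared at a single point of the line.\<close>

lemma lr_stat_line:
  fixes \<Sigma> :: "real^'n^'n"
  assumes \<Sigma>: "pos_def_matrix \<Sigma>" and i: "i \<notin> J"
  shows "lr_stat \<Sigma> J (z + r *\<^sub>R column i \<Sigma>) = lr_stat \<Sigma> J z + 2 * r * z $ i + r\<^sup>2 * \<Sigma> $ i $ i"
proof -
  let ?A = "del_mat J \<Sigma>" and ?B = "del_inv J \<Sigma>" and ?e = "axis i 1 :: real^'n" and ?v = "del_vec J z"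
  have sym: "\<Sigma> $ j $ k = \<Sigma> $ k $ j" for j k
    using \<Sigma> unfolding pos_def_matrix_def transpose_def vec_eq_iff by (metis vec_lambda_beta)
  have tA: "transpose ?A = ?A"
    by (auto simp: vec_eq_iff transpose_def del_mat_def sym)
  have Ag: "del_vec J (column i \<Sigma>) = ?A *v ?e"
    using i by (simp add: vec_eq_iff del_vec_def del_mat_def column_def matrix_vector_mult_basis)
  have BA: "?B *v (?A *v ?e) = ?e"
    using i by (simp add: matrix_vector_mul_assoc del_inv(3)[OF \<Sigma>] flip: del_vec_eq)
      (auto simp: vec_eq_iff del_vec_def axis_def)
  have ABv: "?A *v (?B *v ?v) = ?v"
    by (simp add: matrix_vector_mul_assoc del_inv(2)[OF \<Sigma>] flip: del_vec_eq)
      (auto simp: vec_eq_iff del_vec_def)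
  have A: "(?A *v x) \<bullet> y = x \<bullet> (?A *v y)" for x y
    by (metis dot_lmul_matrix tA transpose_matrix_vector)
  have v: "?v \<bullet> ?e = z $ i" using i by (simp add: inner_axis del_vec_def)
  have Ae: "(?A *v ?e) \<bullet> ?e = \<Sigma> $ i $ i"
    using i by (simp add: inner_axis matrix_vector_mult_basis column_def del_mat_def)
  have d: "del_vec J (z + r *\<^sub>R column i \<Sigma>) = ?v + r *\<^sub>R (?A *v ?e)"
    unfolding Ag[symmetric] by (simp add: vec_eq_iff del_vec_def)
  have "lr_stat \<Sigma> J (z + r *\<^sub>R column i \<Sigma>) = (?v + r *\<^sub>R (?A *v ?e)) \<bullet> (?B *v ?v + r *\<^sub>R ?e)"
    unfolding lr_stat_def d by (simp add: matrix_vector_right_distrib matrix_vector_mult_scaleR BA)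
  also have "\<dots> = ?v \<bullet> (?B *v ?v) + r * (?v \<bullet> ?e) + r * ((?A *v ?e) \<bullet> (?B *v ?v)) + r\<^sup>2 * ((?A *v ?e) \<bullet> ?e)"
    by (simp add: inner_add_left inner_add_right power2_eq_square algebra_simps)
  also have "(?A *v ?e) \<bullet> (?B *v ?v) = z $ i"
    unfolding A ABv using v by (simp add: inner_commute)
  finally show ?thesis by (simp add: v Ae lr_stat_def)
qed

text \<open>With \<open>z $ i = 0\<close> only the entry of the inverse at (k, k) contributes; row k
  of the inverse relation determines it.\<close>

lemma lr_stat_pair:
  fixes \<Sigma> :: "real^'n^'n"
  assumes \<Sigma>: "pos_def_matrix \<Sigma>" and ent: "\<And>i j. \<Sigma> $ i $ j = (if i = j then 1 else \<rho>)"
    and U: "UNIV = {i, j, k}" and d: "i \<noteq> j" "i \<noteq> k" "j \<noteq> k" and z: "z $ i = 0"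
  shows "(1 - \<rho>\<^sup>2) * lr_stat \<Sigma> {j} z = (z $ k)\<^sup>2"
proof -
  let ?B = "del_inv {j} \<Sigma>"
  have sumU: "sum f UNIV = f i + f j + f k" for f :: "'n \<Rightarrow> real"
    unfolding U using d by (simp add: add.assoc)
  have BA: "(?B ** del_mat {j} \<Sigma>) $ k $ l = del_mat {j} (mat 1) $ k $ l" for l
    by (simp add: del_inv(3)[OF \<Sigma>])
  have "?B $ k $ i * \<rho> + ?B $ k $ k = 1" "?B $ k $ i + ?B $ k $ k * \<rho> = 0"
    using BA[of k] BA[of i] d by (simp_all add: matrix_matrix_mult_def sumU del_mat_def mat_def ent)
  then have B: "(1 - \<rho>\<^sup>2) * ?B $ k $ k = 1" by (simp add: power2_eq_square) algebra
  have "lr_stat \<Sigma> {j} z = (z $ k)\<^sup>2 * ?B $ k $ k"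
    using d z by (simp add: lr_stat_def inner_vec_def matrix_vector_mult_def sumU del_vec_def power2_eq_square)
  then show ?thesis using B by (metis mult.left_commute mult.right_neutral)
qed

text \<open>Shrinking u to \<open>c * u\<close> lowers the absolute value of coordinate i by
  \<open>(1 - c) * \<bar>u\<bar>\<close>, and that of coordinate k by no more, because
  \<open>\<rho>\<close> is at most 1 in absolute value. So k keeps its lead, ties included.\<close>

lemma abs_precedes_contract:
  assumes "\<bar>\<rho>\<bar> \<le> 1" "0 \<le> c" "c \<le> 1"
    and x: "x $ i = u" "x $ k = d + u * \<rho>" and y: "y $ i = c * u" "y $ k = d + c * u * \<rho>"
    and p: "abs_precedes x k i"
  shows "abs_precedes y k i"
proof -
  have "\<bar>d + u * \<rho>\<bar> \<le> \<bar>d + c * u * \<rho>\<bar> + \<bar>(1 - c) * u * \<rho>\<bar>"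
    using abs_triangle_ineq[of "d + c * u * \<rho>" "(1 - c) * u * \<rho>"] by (simp add: algebra_simps)
  also have "\<bar>(1 - c) * u * \<rho>\<bar> \<le> (1 - c) * \<bar>u\<bar>"
    using assms(1,3) by (simp add: abs_mult mult_left_le)
  finally have "\<bar>x $ k\<bar> - \<bar>x $ i\<bar> \<le> \<bar>y $ k\<bar> - \<bar>y $ i\<bar>"
    using assms(2) unfolding x y by (simp add: abs_mult algebra_simps)
  then show ?thesis using p unfolding abs_precedes_def by linarith
qed

text \<open>The form at the sum and the difference of two unit vectors is
  \<open>2 + 2 * \<rho>\<close> and \<open>2 - 2 * \<rho>\<close>.\<close>

lemma pos_def_intraclass_bound:
  fixes \<Sigma> :: "real^'n^'n"
  assumes \<Sigma>: "pos_def_matrix \<Sigma>" and ent: "\<And>i j. \<Sigma> $ i $ j = (if i = j then 1 else \<rho>)"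
    and ij: "(i :: 'n) \<noteq> j"
  shows "\<bar>\<rho>\<bar> < 1"
proof -
  have "0 < 2 + 2 * s * \<rho>" if s: "s = 1 \<or> s = - 1" for s
  proof -
    let ?x = "axis i 1 + s *\<^sub>R axis j 1 :: real^'n"
    have "?x $ i = 1" using ij by (simp add: axis_def)
    then have "?x \<noteq> 0" by (metis zero_index zero_neq_one)
    then have "0 < ?x \<bullet> (\<Sigma> *v ?x)" using \<Sigma> unfolding pos_def_matrix_def by blast
    also have "\<Sigma> *v ?x = column i \<Sigma> + s *\<^sub>R column j \<Sigma>"
      by (simp add: matrix_vector_right_distrib matrix_vector_mult_scaleR matrix_vector_mult_basis)
    also have "?x \<bullet> \<dots> = 2 + 2 * s * \<rho>"
      using s ij by (auto simp: inner_add_left inner_axis' column_def ent)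
    finally show ?thesis .
  qed
  from this[of 1] this[of "-1"] show ?thesis by (simp add: abs_less_iff)
qed

text \<open>Along \<open>column i \<Sigma>\<close> the acceptance region is star-shaped about the point where \<open>x\<^sub>i = 0\<close>.
  The only delicate case is \<open>J = {j}\<close> when the larger of the two other coordinates changes
  between the two points: then the new maximum \<open>k\<close> already dominates at \<open>x\<^sub>i = 0\<close>,
  because \<open>x\<^sub>j\<^sup>2 - x\<^sub>k\<^sup>2\<close> is affine on the line.\<close>

lemma lrsd_accept_contract:
  fixes \<Sigma> :: "real^'n::{finite,linorder}^'n::{finite,linorder}"
  assumes card: "CARD('n) = 2 \<or> CARD('n) = 3"
    and ent: "\<And>i j. \<Sigma> $ i $ j = (if i = j then 1 else \<rho>)"
    and \<Sigma>: "pos_def_matrix \<Sigma>" and z: "z $ i = 0" and c: "0 \<le> c" "c \<le> 1"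
    and accept: "lrsd_test \<Sigma> C i (z + u *\<^sub>R column i \<Sigma>) = 0"
  shows "lrsd_test \<Sigma> C i (z + (c * u) *\<^sub>R column i \<Sigma>) = 0"
proof (cases "c = 1")
  case True
  then show ?thesis using accept by simp
next
  case False
  then have c1: "c < 1" using c by simp
  let ?x = "z + u *\<^sub>R column i \<Sigma>" and ?y = "z + (c * u) *\<^sub>R column i \<Sigma>"
  obtain J where J: "abs_upper_set ?x J" "i \<notin> J" "lr_stat \<Sigma> J ?x < C (card J + 1)"
    using accept unfolding lrsd_test_eq_0_iff by blast
  obtain i' where i': "i' \<noteq> i"
  proof -
    have "UNIV \<noteq> {i}"
    proof
      assume "UNIV = {i}"
      then have "CARD('n) = card {i}" by (rule arg_cong)
      then show False using card by simp
    qed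
    then show ?thesis using that by auto
  qed
  have \<rho>: "\<bar>\<rho>\<bar> < 1" using pos_def_intraclass_bound[OF \<Sigma> ent i'] .
  have stat: "lr_stat \<Sigma> J (z + r *\<^sub>R column i \<Sigma>) = lr_stat \<Sigma> J z + r\<^sup>2" if "i \<notin> J" for r J
    using lr_stat_line[OF \<Sigma> that, of z r] z by (simp add: ent)
  have cu: "(c * u)\<^sup>2 \<le> u\<^sup>2"
    using c by (simp add: power_mult_distrib mult_left_le_one_le power_le_one)
  have less: "lr_stat \<Sigma> J ?y < C (card J + 1)"
    using J(3) stat[OF J(2)] cu by simp
  have coord: "(z + r *\<^sub>R column i \<Sigma>) $ i = r" "k \<noteq> i \<Longrightarrow> (z + r *\<^sub>R column i \<Sigma>) $ k = z $ k + r * \<rho>" for r k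
    using z by (simp_all add: column_def ent)
  have prec: "abs_precedes ?y k i" if "abs_precedes ?x k i" for k
  proof -
    have "k \<noteq> i" using that by (auto simp: abs_precedes_def)
    show ?thesis
      by (rule abs_precedes_contract[OF less_imp_le[OF \<rho>] c coord(1) coord(2)[OF \<open>k \<noteq> i\<close>]
            coord(1) coord(2)[OF \<open>k \<noteq> i\<close>] that])
  qed
  have precJ: "abs_precedes ?y j i" if "j \<in> J" for j
    using J(1,2) that unfolding abs_upper_set_def by (intro prec) blast
  show ?thesis
  proof (cases "abs_upper_set ?y J")
    case True
    then show ?thesis using J(2) less unfolding lrsd_test_eq_0_iff by blast
  next
    case False
    \<comment> \<open>The index k that spoils the order is not i, since J still precedes i at the
      new point. Thus i, j, k are three different indices, which excludes M = 2 and leaves J =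
      {j}.\<close>
    then obtain j k where jk: "j \<in> J" "k \<notin> J" "\<not> abs_precedes ?y j k"
      unfolding abs_upper_set_def by blast
    then have ik: "k \<noteq> i" using precJ by auto
    have dist: "i \<noteq> j" "i \<noteq> k" "j \<noteq> k" using jk J(2) ik by auto
    have U: "UNIV = {i, j, k}"
    proof -
      have "card {i, j, k} = 3" using dist by simp
      moreover have "card {i, j, k} \<le> CARD('n)" by (intro card_mono) auto
      ultimately show ?thesis using card by (intro card_subset_eq[symmetric]) auto
    qed
    have Jj: "J = {j}" using jk J(2) U by auto
    have kj: "abs_precedes ?y k j" using jk abs_precedes_total dist by blast
    have jkx: "abs_precedes ?x j k" using J(1) jk by (auto simp: abs_upper_set_def)
    \<comment> \<open>Acceptance at the new point will be witnessed by {k}. It has the same size as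
      {j}, hence the same critical constant.\<close>
    have upper: "abs_upper_set ?y {k}"
      unfolding abs_upper_set_def
    proof (intro ballI allI impI)
      fix a b assume "a \<in> {k}" "b \<notin> {k}"
      then have "a = k" "b = i \<or> b = j" using U by auto
      then show "abs_precedes ?y a b"
        using kj abs_precedes_trans[OF kj precJ[OF jk(1)]] by auto
    qed
    have "(?y $ j)\<^sup>2 \<le> (?y $ k)\<^sup>2" "(?x $ k)\<^sup>2 \<le> (?x $ j)\<^sup>2"
      using kj jkx by (auto simp: abs_precedes_def abs_le_square_iff[symmetric])
    then have y: "(z $ j + c * u * \<rho>)\<^sup>2 \<le> (z $ k + c * u * \<rho>)\<^sup>2"
      and x: "(z $ k + u * \<rho>)\<^sup>2 \<le> (z $ j + u * \<rho>)\<^sup>2"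
      unfolding coord(2)[OF dist(1)[symmetric]] coord(2)[OF dist(2)[symmetric]] .
    \<comment> \<open>The difference of squares is affine in the line parameter because both
      coordinates move with the same slope \<open>\<rho>\<close>. Its value at \<open>c * u\<close>
      is the mean of its values at 0 and u with weights 1 - c and c; this is solved for the value at
      0.\<close>
    have "(1 - c) * ((z $ j)\<^sup>2 - (z $ k)\<^sup>2) =
      ((z $ j + c * u * \<rho>)\<^sup>2 - (z $ k + c * u * \<rho>)\<^sup>2) - c * ((z $ j + u * \<rho>)\<^sup>2 - (z $ k + u * \<rho>)\<^sup>2)"
      by (simp add: power2_eq_square algebra_simps)
    also have "\<dots> \<le> 0"
      using mult_nonneg_nonneg[OF c(1), of "(z $ j + u * \<rho>)\<^sup>2 - (z $ k + u * \<rho>)\<^sup>2"] x y by linarith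
    finally have zz: "(z $ j)\<^sup>2 \<le> (z $ k)\<^sup>2" using c1 by (simp add: mult_le_0_iff)
    have "\<rho>\<^sup>2 < 1" using \<rho> by (simp add: abs_square_less_1)
    moreover have "(1 - \<rho>\<^sup>2) * lr_stat \<Sigma> {k} z \<le> (1 - \<rho>\<^sup>2) * lr_stat \<Sigma> {j} z"
    proof -
      have U': "UNIV = {i, k, j}" using U by auto
      show ?thesis
        using lr_stat_pair[OF \<Sigma> ent U dist z] lr_stat_pair[OF \<Sigma> ent U' dist(2,1) dist(3)[symmetric] z] zz by simp
    qed
    ultimately have "lr_stat \<Sigma> {k} z \<le> lr_stat \<Sigma> {j} z" by simp
    moreover have "i \<notin> {k}" "i \<notin> {j}" using dist by auto
    ultimately have "lr_stat \<Sigma> {k} ?y \<le> lr_stat \<Sigma> {j} ?y"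
      unfolding stat[OF \<open>i \<notin> {k}\<close>] stat[OF \<open>i \<notin> {j}\<close>] by simp
    then have "lr_stat \<Sigma> {k} ?y < C (card {k} + 1)" using less unfolding Jj by simp
    then show ?thesis using upper dist(2) unfolding lrsd_test_eq_0_iff by blast
  qed
qed

lemma is_interval_star_0:
  fixes S :: "real set"
  assumes "\<And>u c. u \<in> S \<Longrightarrow> 0 \<le> c \<Longrightarrow> c \<le> 1 \<Longrightarrow> c * u \<in> S"
  shows "is_interval S"
  unfolding is_interval_1
proof (intro ballI allI impI)
  fix a b t assume ab: "a \<in> S" "b \<in> S" and t: "a \<le> t \<and> t \<le> b"
  show "t \<in> S"
  proof (cases "t = 0")
    case True
    then show ?thesis using assms[OF ab(1), of 0] by simp
  next
    case False
    then consider "0 < t" | "t < 0" by linarith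
    then show ?thesis
    proof cases
      case 1
      then show ?thesis using assms[OF ab(2), of "t / b"] t by simp
    next
      case 2
      then have "0 \<le> t / a" "t / a \<le> 1" using t by (auto simp: divide_nonpos_nonpos divide_le_eq_1)
      then show ?thesis using assms[OF ab(1), of "t / a"] 2 t by simp
    qed
  qed
qed

theorem theorem4p1:
  fixes \<Sigma> :: "real^'n::{finite,linorder}^'n::{finite,linorder}" and \<rho> :: real and C :: "nat \<Rightarrow> real"
  assumes "CARD('n) = 2 \<or> CARD('n) = 3"
    and "\<And>i j. \<Sigma> $ i $ j = (if i = j then 1 else \<rho>)"
    and "\<rho> \<noteq> 0"
    and "pos_def_matrix \<Sigma>"
    and "strict_antimono_on {1..CARD('n)} C"
    and "C CARD('n) > 0"
  shows "\<forall>i. admissible \<Sigma> i (lrsd_test \<Sigma> C i)"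
proof
  fix i
  show "admissible \<Sigma> i (lrsd_test \<Sigma> C i)"
  proof (rule interval_sections_admissible[OF assms(4) lrsd_test_measurable lrsd_test_cases])
    fix x :: "real^'n::{finite,linorder}"
    let ?g = "column i \<Sigma>"
    \<comment> \<open>The point of the line with i-th coordinate 0, as the diagonal of
      \<open>\<Sigma>\<close> is 1. The sections through x and through z differ by a translation,
      which preserves intervals.\<close>
    define z where "z = x - (x $ i) *\<^sub>R ?g"
    have z: "z $ i = 0" by (simp add: z_def column_def assms(2))
    define S where "S = {u. lrsd_test \<Sigma> C i (z + u *\<^sub>R ?g) = 0}"
    have "is_interval S"
    proof (rule is_interval_star_0)
      fix u c :: real assume "u \<in> S" "0 \<le> c" "c \<le> 1"
      then show "c * u \<in> S"
        using lrsd_accept_contract[OF assms(1,2,4) z, of c C u] by (simp add: S_def)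
    qed
    moreover have "x + r *\<^sub>R ?g = z + (x $ i + r) *\<^sub>R ?g" for r
      by (simp add: z_def scaleR_left_distrib)
    then have "{r. lrsd_test \<Sigma> C i (x + r *\<^sub>R ?g) = 0} = {r. x $ i + r \<in> S}"
      by (simp only: S_def mem_Collect_eq)
    ultimately show "is_interval {r. lrsd_test \<Sigma> C i (x + r *\<^sub>R ?g) = 0}"
      unfolding is_interval_1 by (metis add_left_mono mem_Collect_eq)
  qed
qed

end
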